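(* Let $G$ be an infinite discrete abelian group and let $(X,G)$ be a minimal system. Then $(X,G)$ is a system of order $\infty$ if and only if it is pairwise FIP$^*$-equicontinuous.
   Context: A system $(X,G)$ consists of a (nonempty) compact metric space $X$ with compatible metric $d$ and an infinite discrete group $G$ acting continuously on $X$. It is minimal if it has no proper nonempty closed $G$-invariant subset. For a finite sequence $\{p_i\}_{i=1}^k$ in $G$, $FP(\{p_i\}_{i=1}^k)=\{\prod_{i\in\alpha}p_i:\emptyset\ne\alpha\subset\{1,\dots,k\}\}$, products taken in increasing order of indices. $F\subset G$ is an FIP-set if for every $k\in\mathbb{N}$ there is a finite sequence $\{p^{(k)}_i\}_{i=1}^k$ in $G$ with $FP(\{p^{(k)}_i\}_{i=1}^k)\subset F$; $F$ is an FIP$^*$-set if it meets every FIP-set in $G$. A point $x\in X$ is pairwise FIP$^*$-equicontinuous if for every $\varepsilon>0$ there is a neighborhood $U$ of $x$ such that for all $y,z\in U$ the set $\{g\in G: d(gy,gz)<\varepsilon\}$ is an FIP$^*$-set. $(X,G)$ is pairwise FIP$^*$-equicontinuous if every point of $X$ is. For a minimal system $(X,G)$ and $k\ge1$, $\mathbf{RP}^{[k]}(X,G)$ is the set of pairs $(x,y)\in X\times X$ such that for every $\delta>0$ there exist $x',y'\in X$ and a sequence $\{p_i\}_{i=1}^k$ in $G$ with $d(x,x')<\delta$, $d(y,y')<\delta$ and $d(gx',gy')<\delta$ for all $g\in FP(\{p_i\}_{i=1}^k)$. Put $\mathbf{RP}^{[\infty]}(X,G)=\bigcap_{k\ge1}\mathbf{RP}^{[k]}(X,G)$.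 $(X,G)$ is a system of order $\infty$ if $\mathbf{RP}^{[\infty]}(X,G)$ equals the diagonal of $X\times X$. *)

theory Defs
  imports "HOL-Analysis.Analysis" "HOL-Algebra.Group_Action"
begin

text \<open>
  The compact metric space is a nonempty compact subset \<open>X\<close> of a metric type, with the induced
  metric. The action is \<open>\<phi>\<close>, so that \<open>\<phi> g x\<close> is the point \<open>gx\<close>; as usual for
  \<^locale>\<open>group_action\<close>, each \<open>\<phi> g\<close> is a bijection of \<open>X\<close>, undefined outside \<open>X\<close>.
\<close>

locale dynamical_system = group_action G X \<phi>
  for G :: "('g, 'm) monoid_scheme" (structure)
    and X :: "'a::metric_space set"
    and \<phi> :: "'g \<Rightarrow> 'a \<Rightarrow> 'a" +
  assumes infinite_group: "infinite (carrier G)"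
    and compact_space: "compact X"
    and nonempty_space: "X \<noteq> {}"
    and continuous_action:
      "continuous_map (prod_topology (discrete_topology (carrier G)) (top_of_set X)) (top_of_set X)
         (\<lambda>(g, x). \<phi> g x)"

locale minimal_system = dynamical_system G X \<phi>
  for G :: "('g, 'm) monoid_scheme" (structure)
    and X :: "'a::metric_space set"
    and \<phi> :: "'g \<Rightarrow> 'a \<Rightarrow> 'a" +
  assumes minimal:
    "\<And>A. closedin (top_of_set X) A \<Longrightarrow> A \<noteq> {} \<Longrightarrow> (\<And>g. g \<in> carrier G \<Longrightarrow> \<phi> g ` A \<subseteq> A) \<Longrightarrow> A = X"

text \<open>
  Only the values \<open>p 1, \<dots>, p k\<close> of \<open>p\<close> matter. The group need not be commutative here, so
  the product is taken along the increasing enumeration of the index set.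
\<close>

definition FP :: "('g, 'm) monoid_scheme \<Rightarrow> nat \<Rightarrow> (nat \<Rightarrow> 'g) \<Rightarrow> 'g set" where
  "FP G k p = {foldr (\<otimes>\<^bsub>G\<^esub>) (map p (sorted_list_of_set \<alpha>)) \<one>\<^bsub>G\<^esub> | \<alpha>. \<alpha> \<noteq> {} \<and> \<alpha> \<subseteq> {1..k}}"

definition FIP_set :: "('g, 'm) monoid_scheme \<Rightarrow> 'g set \<Rightarrow> bool" where
  "FIP_set G F \<longleftrightarrow>
     F \<subseteq> carrier G \<and> (\<forall>k\<ge>1. \<exists>p. p \<in> {1..k} \<rightarrow> carrier G \<and> FP G k p \<subseteq> F)"

definition FIP_star_set :: "('g, 'm) monoid_scheme \<Rightarrow> 'g set \<Rightarrow> bool" where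
  "FIP_star_set G F \<longleftrightarrow> F \<subseteq> carrier G \<and> (\<forall>E. FIP_set G E \<longrightarrow> F \<inter> E \<noteq> {})"

definition pairwise_FIP_star_equicontinuous_point ::
  "('g, 'm) monoid_scheme \<Rightarrow> 'a::metric_space set \<Rightarrow> ('g \<Rightarrow> 'a \<Rightarrow> 'a) \<Rightarrow> 'a \<Rightarrow> bool" where
  "pairwise_FIP_star_equicontinuous_point G X \<phi> x \<longleftrightarrow>
     (\<forall>\<epsilon>>0. \<exists>U. openin (top_of_set X) U \<and> x \<in> U \<and>
        (\<forall>y\<in>U. \<forall>z\<in>U. FIP_star_set G {g \<in> carrier G. dist (\<phi> g y) (\<phi> g z) < \<epsilon>}))"

definition pairwise_FIP_star_equicontinuous ::
  "('g, 'm) monoid_scheme \<Rightarrow> 'a::metric_space set \<Rightarrow> ('g \<Rightarrow> 'a \<Rightarrow> 'a) \<Rightarrow> bool" where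
  "pairwise_FIP_star_equicontinuous G X \<phi> \<longleftrightarrow>
     (\<forall>x\<in>X. pairwise_FIP_star_equicontinuous_point G X \<phi> x)"

definition RP ::
  "('g, 'm) monoid_scheme \<Rightarrow> 'a::metric_space set \<Rightarrow> ('g \<Rightarrow> 'a \<Rightarrow> 'a) \<Rightarrow> nat \<Rightarrow> ('a \<times> 'a) set" where
  "RP G X \<phi> k = {(x, y) \<in> X \<times> X. \<forall>\<delta>>0. \<exists>x'\<in>X. \<exists>y'\<in>X. \<exists>p. p \<in> {1..k} \<rightarrow> carrier G \<and>
     dist x x' < \<delta> \<and> dist y y' < \<delta> \<and> (\<forall>g\<in>FP G k p. dist (\<phi> g x') (\<phi> g y') < \<delta>)}"

definition RP_infinity ::
  "('g, 'm) monoid_scheme \<Rightarrow> 'a::metric_space set \<Rightarrow> ('g \<Rightarrow> 'a \<Rightarrow> 'a) \<Rightarrow> ('a \<times> 'a) set" where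
  "RP_infinity G X \<phi> = (\<Inter>k\<in>{1..}. RP G X \<phi> k)"

definition system_of_order_infinity ::
  "('g, 'm) monoid_scheme \<Rightarrow> 'a::metric_space set \<Rightarrow> ('g \<Rightarrow> 'a \<Rightarrow> 'a) \<Rightarrow> bool" where
  "system_of_order_infinity G X \<phi> \<longleftrightarrow> RP_infinity G X \<phi> = Id_on X"

end

theory Submission
  imports Defs "HOL-Algebra.FiniteProduct"
begin

text \<open>
  Suppose the system has order \<open>\<infinity>\<close> and equicontinuity fails at \<open>x\<close>. Then there are points \<open>y, z\<close>
  close to \<open>x\<close> whose images under arbitrarily long finite product sets stay apart. By Folkman's
  theorem one may pass to sub-products along which \<open>gy\<close> is almost a constant \<open>a\<close> and \<open>gz\<close> almost a
  constant \<open>b\<close>. Comparing \<open>y\<close> and \<open>z\<close> with their images under one of the generators shows that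
  \<open>(x, a)\<close> and \<open>(x, b)\<close> lie in every \<open>RP k\<close>, so \<open>a = x = b\<close>, a contradiction.

  Conversely, equicontinuity first gives distality: if \<open>x \<noteq> y\<close> are proximal, then minimality yields
  finite product sets of every length that move \<open>x\<close> near \<open>y\<close>, whereas by recurrence some \<open>v\<close>
  near \<open>x\<close> returns near \<open>x\<close> along sub-products of them; the pair \<open>(x, v)\<close> contradicts
  equicontinuity at \<open>x\<close>. In a distal system every point is minimal under every group acting
  coordinatewise on a power of \<open>X\<close>, hence Host--Kra cubes can be glued along faces. Gluing shows
  that a pair \<open>(x, y)\<close> in \<open>RP k\<close> gives a cube with \<open>x\<close> at one vertex and \<open>y\<close> at all the others,
  that is, points near \<open>x\<close> which a whole finite product set moves near \<open>y\<close>. The recurrence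
  argument then applies once more and excludes \<open>x \<noteq> y\<close>.
\<close>

section \<open>Folkman's theorem\<close>

text \<open>An FIP-set may carry unrelated sequences for different lengths and need not contain all
  products of one infinite sequence. Every pigeonhole step must therefore be finitary: the length
  required by Folkman's theorem depends only on the number of colors and on the desired length. The
  quantifiers are the second obstacle. Failure of equicontinuity asks for one pair of points and one
  FIP-set, while regional proximality offers new points for each length and tolerance. The converse
  therefore shrinks compact sets of points together with open sets of returning points and collects
  one product set per stage. For regionally proximal pairs these compact sets need interior, so that
  a translate of \<open>x\<close> lies in each of them and the next cube can start there. Distality
  has two further uses: it makes the family of cubes that come near the diagonal closed, and it
  bounds the distance between all common translates of \<open>x\<close> and \<open>y\<close> from
  below. Idempotents of compact semigroups occur twice: among ultrafilters for Folkman's theorem and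
  in the enveloping semigroup.\<close>

lemma compact_imp_closed_fun:
  fixes K :: "('i \<Rightarrow> 'b::t2_space) set"
  assumes "compact K"
  shows "closed K"
proof -
  have "Hausdorff_space (euclidean :: ('i \<Rightarrow> 'b) topology)"
  proof -
    have "Hausdorff_space (euclidean :: 'b topology)"
      unfolding Hausdorff_space_def disjnt_def using hausdorff by auto
    then show ?thesis
      unfolding euclidean_product_topology[symmetric] by (intro Hausdorff_space_product_topology[THEN iffD2] disjI2 ballI)
  qed
  then show ?thesis
    using assms compactin_imp_closedin by (metis closed_closedin compactin_euclidean_iff)
qed

text \<open>In a minimal compact subsemigroup \<open>T\<close> the translate
  \<open>T \<star> e\<close> is again a compact subsemigroup, hence all of \<open>T\<close>, and so
  contains \<open>e\<close>. The solutions of \<open>p \<star> e = e\<close> are then a nonempty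
  compact subsemigroup, hence all of \<open>T\<close>, and \<open>e\<close> is among them.\<close>

lemma ellis_numakura:
  fixes S :: "('i \<Rightarrow> 'b::t2_space) set" and mul :: "('i \<Rightarrow> 'b) \<Rightarrow> ('i \<Rightarrow> 'b) \<Rightarrow> ('i \<Rightarrow> 'b)" (infixl "\<star>" 70)
  assumes "compact S" "S \<noteq> {}"
    and closed: "\<And>p q. p \<in> S \<Longrightarrow> q \<in> S \<Longrightarrow> p \<star> q \<in> S"
    and assoc: "\<And>p q r. p \<in> S \<Longrightarrow> q \<in> S \<Longrightarrow> r \<in> S \<Longrightarrow> (p \<star> q) \<star> r = p \<star> (q \<star> r)"
    and cont: "\<And>q. q \<in> S \<Longrightarrow> continuous_on S (\<lambda>p. p \<star> q)"
  shows "\<exists>e\<in>S. e \<star> e = e"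
proof -
  define \<A> where "\<A> = {T. T \<subseteq> S \<and> compact T \<and> T \<noteq> {} \<and> (\<forall>p\<in>T. \<forall>q\<in>T. p \<star> q \<in> T)}"
  \<comment> \<open>Complements turn the minimal member sought into a maximal one, to which Zorn's
    lemma applies.\<close>
  have "\<exists>M\<in>uminus ` \<A>. \<forall>T\<in>uminus ` \<A>. M \<subseteq> T \<longrightarrow> T = M"
  proof (rule subset_Zorn_nonempty)
    show "uminus ` \<A> \<noteq> {}"
      using assms(1-3) by (auto simp: \<A>_def)
    fix \<C> :: "('i \<Rightarrow> 'b) set set" assume \<C>: "\<C> \<noteq> {}" "subset.chain (uminus ` \<A>) \<C>"
    define \<D> where "\<D> = uminus ` \<C>"
    have sub: "\<D> \<subseteq> \<A>" "\<D> \<noteq> {}"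
      using \<C> by (force simp: \<D>_def subset.chain_def)+
    have ch: "T \<subseteq> U \<or> U \<subseteq> T" if "T \<in> \<D>" "U \<in> \<D>" for T U
      using that \<C>(2) unfolding \<D>_def subset.chain_def by blast
    obtain T0 where T0: "T0 \<in> \<D>" using sub by blast
    have "T0 \<inter> \<Inter>\<D> \<noteq> {}"
    proof (rule compact_imp_fip)
      show "compact T0" using T0 sub by (auto simp: \<A>_def)
      show "closed T" if "T \<in> \<D>" for T
        using that sub by (auto simp: \<A>_def compact_imp_closed_fun)
      fix \<F> assume \<F>: "finite \<F>" "\<F> \<subseteq> \<D>"
      then have "subset.chain \<D> (insert T0 \<F>)"
        using T0 ch by (auto simp: subset_chain_def)
      then have "\<Inter>(insert T0 \<F>) \<in> \<D>"
        using Inter_in_chain[of "insert T0 \<F>" \<D>] \<F> T0 by (metis finite.insertI insert_not_empty insert_subset subsetD)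
      then have "\<Inter>(insert T0 \<F>) \<in> \<A>" using sub(1) by (rule subsetD[rotated])
      then show "T0 \<inter> \<Inter>\<F> \<noteq> {}" by (simp add: \<A>_def)
    qed
    then have "\<Inter>\<D> \<noteq> {}" by blast
    moreover have "compact (\<Inter>\<D>)"
    proof -
      have "closed T" if "T \<in> \<D>" for T
        using that sub by (auto simp: \<A>_def compact_imp_closed_fun)
      then have "closed (\<Inter>\<D>)" by blast
      moreover obtain T0 where "T0 \<in> \<D>" using sub by blast
      ultimately show ?thesis
        using sub compact_Int_closed[of T0 "\<Inter>\<D>"] by (auto simp: \<A>_def Int_absorb1 Inter_lower)
    qed
    ultimately have "\<Inter>\<D> \<in> \<A>"
      using sub unfolding \<A>_def by blast
    moreover have "\<Union>\<C> = - \<Inter>\<D>" by (auto simp: \<D>_def)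
    ultimately show "\<Union>\<C> \<in> uminus ` \<A>" by blast
  qed
  then obtain T where T: "T \<in> \<A>" and min: "\<And>U. U \<in> \<A> \<Longrightarrow> U \<subseteq> T \<Longrightarrow> U = T"
    by (metis (no_types, lifting) Compl_subset_Compl_iff double_compl imageE imageI)
  then obtain e where e: "e \<in> T" and TS: "T \<subseteq> S" and cT: "compact T"
    and mT: "\<And>p q. p \<in> T \<Longrightarrow> q \<in> T \<Longrightarrow> p \<star> q \<in> T"
    unfolding \<A>_def by blast
  have c: "continuous_on T (\<lambda>p. p \<star> e)"
    using cont e TS continuous_on_subset by blast
  have "(\<lambda>p. p \<star> e) ` T \<in> \<A>"
    unfolding \<A>_def
  proof (intro CollectI conjI ballI)
    show "(\<lambda>p. p \<star> e) ` T \<subseteq> S" using mT e TS by blast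
    show "compact ((\<lambda>p. p \<star> e) ` T)" using c cT compact_continuous_image by blast
    show "(\<lambda>p. p \<star> e) ` T \<noteq> {}" using e by blast
    fix p q assume "p \<in> (\<lambda>p. p \<star> e) ` T" "q \<in> (\<lambda>p. p \<star> e) ` T"
    then obtain p' q' where *: "p' \<in> T" "p = p' \<star> e" "q' \<in> T" "q = q' \<star> e" by blast
    have "(p' \<star> e) \<star> (q' \<star> e) = (p' \<star> e \<star> q') \<star> e"
      using * e mT TS by (intro assoc[symmetric]) auto
    then have "p \<star> q = (p' \<star> e \<star> q') \<star> e" using * by simp
    then show "p \<star> q \<in> (\<lambda>p. p \<star> e) ` T" using * e mT by blast
  qed
  then have "(\<lambda>p. p \<star> e) ` T = T" using min mT e by blast
  then obtain p where p: "p \<in> T" "p \<star> e = e" using e by (metis imageE)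
  define U where "U = {p \<in> T. p \<star> e = e}"
  have "U \<in> \<A>"
    unfolding \<A>_def
  proof (intro CollectI conjI ballI)
    have "T \<inter> (\<lambda>p. p \<star> e) -` {e} = U" by (auto simp: U_def)
    moreover have "closed {e}" by (simp add: compact_imp_closed_fun)
    ultimately have "closedin (top_of_set T) U"
      using continuous_closedin_preimage [OF c] by metis
    then show "compact U"
      using cT closedin_compact by blast
    show "U \<noteq> {}" using p by (auto simp: U_def)
    fix q r assume "q \<in> U" "r \<in> U"
    then have "q \<in> T" "r \<in> T" "q \<star> e = e" "r \<star> e = e" by (auto simp: U_def)
    moreover have "(q \<star> r) \<star> e = q \<star> (r \<star> e)" using calculation e TS by (intro assoc) auto
    ultimately show "q \<star> r \<in> U"
      using mT by (simp add: U_def)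
  qed (use TS in \<open>auto simp: U_def\<close>)
  then have "U = T" by (intro min) (auto simp: U_def)
  then show ?thesis using e TS by (auto simp: U_def)
qed

text \<open>Tychonoff for finite discrete factors: the closures of the tails are nested and have a
  common point. The index set may be uncountable, so agreement on finite sets takes the place of a
  convergent subsequence.\<close>

lemma pointwise_cluster_point:
  fixes f :: "nat \<Rightarrow> 'i \<Rightarrow> 'b"
  assumes "\<And>n i. f n i \<in> C i" "\<And>i. finite (C i)"
  shows "\<exists>g. \<forall>S N. finite S \<longrightarrow> (\<exists>n\<ge>N. \<forall>i\<in>S. f n i = g i)"
proof -
  define P where "P = product_topology (\<lambda>i. discrete_topology (C i)) UNIV"
  have cP: "compact_space P"
    using assms(2) by (simp add: P_def compact_space_product_topology compact_space_discrete_topology)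
  have top: "f n \<in> topspace P" for n
    using assms(1) by (auto simp: P_def)
  define K where "K N = P closure_of (f ` {N..})" for N
  have "(\<Inter>N. K N) \<noteq> {}"
  proof (rule compact_space_imp_nest [OF cP])
    show "closedin P (K n)" for n by (simp add: K_def)
    have "f n \<in> K n" for n
      unfolding K_def using closure_of_subset[of "f ` {n..}" P] top by (simp add: image_subset_iff)
    then show "K n \<noteq> {}" for n by blast
    show "decseq K" unfolding K_def decseq_def
      by (intro allI impI closure_of_mono image_mono) auto
  qed
  then obtain g where g: "\<And>N. g \<in> K N" by blast
  show ?thesis
  proof (rule exI[of _ g], intro allI impI)
    fix S :: "'i set" and N assume S: "finite S"
    have gC: "g i \<in> C i" for i
      using g[of 0] closure_of_subset_topspace[of P] unfolding K_def P_def by (auto simp: PiE_def Pi_def)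
    have "openin P (PiE UNIV (\<lambda>i. if i \<in> S then {g i} else C i))"
      unfolding P_def
    proof (rule product_topology_basis)
      show "openin (discrete_topology (C i)) (if i \<in> S then {g i} else C i)" for i using gC by auto
      show "finite {i. (if i \<in> S then {g i} else C i) \<noteq> topspace (discrete_topology (C i))}"
        using S by (rule finite_subset[rotated]) auto
    qed
    moreover have "g \<in> PiE UNIV (\<lambda>i. if i \<in> S then {g i} else C i)" using gC by auto
    ultimately obtain h where "h \<in> f ` {N..}" "h \<in> PiE UNIV (\<lambda>i. if i \<in> S then {g i} else C i)"
      using g[of N] unfolding K_def in_closure_of by blast
    then obtain n where "n \<ge> N" "f n \<in> PiE UNIV (\<lambda>i. if i \<in> S then {g i} else C i)" by blast
    then have "\<forall>i\<in>S. f n i = g i" by (force simp: PiE_def Pi_def split: if_splits)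
    then show "\<exists>n\<ge>N. \<forall>i\<in>S. f n i = g i" using \<open>n \<ge> N\<close> by blast
  qed
qed

text \<open>An ultrafilter is represented by the predicate of being one of its members.\<close>

definition tail_ultrafilter :: "(nat set set \<Rightarrow> bool) \<Rightarrow> bool" where
  "tail_ultrafilter p \<longleftrightarrow> (\<forall>A B. p (A \<inter> B) \<longleftrightarrow> p A \<and> p B) \<and> (\<forall>A. p (- A) \<longleftrightarrow> \<not> p A) \<and>
     (\<forall>m. p {\<alpha>. finite \<alpha> \<and> \<alpha> \<noteq> {} \<and> \<alpha> \<subseteq> {m..}})"

text \<open>The extension of union from finite sets to ultrafilters. Its value at \<open>A\<close>
  is the value of \<open>p\<close> at a set that depends only on \<open>q\<close> and
  \<open>A\<close>, so it is continuous in \<open>p\<close>, as the idempotent argument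
  requires.\<close>

definition ultra_union :: "(nat set set \<Rightarrow> bool) \<Rightarrow> (nat set set \<Rightarrow> bool) \<Rightarrow> nat set set \<Rightarrow> bool" where
  "ultra_union p q A \<longleftrightarrow> p {\<alpha>. q {\<beta>. \<alpha> \<union> \<beta> \<in> A}}"

lemma tail_ultrafilterD:
  assumes "tail_ultrafilter p"
  shows "p (A \<inter> B) \<longleftrightarrow> p A \<and> p B" "p (- A) \<longleftrightarrow> \<not> p A" "p {\<alpha>. finite \<alpha> \<and> \<alpha> \<noteq> {} \<and> \<alpha> \<subseteq> {m..}}"
    "p UNIV" "\<not> p {}" "A \<subseteq> B \<Longrightarrow> p A \<Longrightarrow> p B"
proof -
  show i: "p (A \<inter> B) \<longleftrightarrow> p A \<and> p B" for A B
    using assms unfolding tail_ultrafilter_def by blast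
  show "p (- A) \<longleftrightarrow> \<not> p A" and t: "p {\<alpha>. finite \<alpha> \<and> \<alpha> \<noteq> {} \<and> \<alpha> \<subseteq> {m..}}" for A m
    using assms unfolding tail_ultrafilter_def by blast+
  show m: "p B" if "A \<subseteq> B" "p A" for A B
    using that i[of A B] by (simp add: Int_absorb2)
  show "p UNIV" using m t by blast
  then show "\<not> p {}" using assms unfolding tail_ultrafilter_def by (metis Compl_UNIV_eq)
qed

lemma tail_ultrafilter_Inter:
  assumes "tail_ultrafilter p" "finite I" "\<And>i. i \<in> I \<Longrightarrow> p (A i)"
  shows "p {x. \<forall>i\<in>I. x \<in> A i}"
  using assms(2,3)
proof (induction I)
  case (insert i I)
  have "{x. \<forall>j\<in>insert i I. x \<in> A j} = A i \<inter> {x. \<forall>j\<in>I. x \<in> A j}" by auto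
  then show ?case using insert tail_ultrafilterD(1)[OF assms(1)] by simp
qed (use tail_ultrafilterD(4)[OF assms(1)] in simp)

lemma tail_ultrafilter_union:
  assumes p: "tail_ultrafilter p" and q: "tail_ultrafilter q"
  shows "tail_ultrafilter (ultra_union p q)"
  unfolding tail_ultrafilter_def
proof (intro conjI allI)
  note pD = tail_ultrafilterD[OF p] and qD = tail_ultrafilterD[OF q]
  fix A B :: "nat set set" and m :: nat
  have "{\<beta>. \<alpha> \<union> \<beta> \<in> A \<inter> B} = {\<beta>. \<alpha> \<union> \<beta> \<in> A} \<inter> {\<beta>. \<alpha> \<union> \<beta> \<in> B}" for \<alpha> by blast
  then have "{\<alpha>. q {\<beta>. \<alpha> \<union> \<beta> \<in> A \<inter> B}} = {\<alpha>. q {\<beta>. \<alpha> \<union> \<beta> \<in> A}} \<inter> {\<alpha>. q {\<beta>. \<alpha> \<union> \<beta> \<in> B}}"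
    using qD(1) by auto
  then show "ultra_union p q (A \<inter> B) \<longleftrightarrow> ultra_union p q A \<and> ultra_union p q B"
    by (simp only: ultra_union_def pD(1))
  have "{\<beta>. \<alpha> \<union> \<beta> \<in> - A} = - {\<beta>. \<alpha> \<union> \<beta> \<in> A}" for \<alpha> by blast
  then have "{\<alpha>. q {\<beta>. \<alpha> \<union> \<beta> \<in> - A}} = - {\<alpha>. q {\<beta>. \<alpha> \<union> \<beta> \<in> A}}"
    using qD(2) by auto
  then show "ultra_union p q (- A) \<longleftrightarrow> \<not> ultra_union p q A"
    by (simp only: ultra_union_def pD(2))
  define T where "T = {\<alpha>. finite \<alpha> \<and> \<alpha> \<noteq> {} \<and> \<alpha> \<subseteq> {m..}}"
  have "q {\<beta>. \<alpha> \<union> \<beta> \<in> T}" if "\<alpha> \<in> T" for \<alpha>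
    by (rule qD(6)[OF _ qD(3)[of m]]) (use that in \<open>auto simp: T_def\<close>)
  then have "T \<subseteq> {\<alpha>. q {\<beta>. \<alpha> \<union> \<beta> \<in> T}}" by blast
  then have "p {\<alpha>. q {\<beta>. \<alpha> \<union> \<beta> \<in> T}}"
    by (rule pD(6)) (simp add: T_def pD(3))
  then show "ultra_union p q {\<alpha>. finite \<alpha> \<and> \<alpha> \<noteq> {} \<and> \<alpha> \<subseteq> {m..}}"
    by (simp add: ultra_union_def T_def)
qed

text \<open>A cluster point of the principal ultrafilters at \<open>{n}\<close>: each axiom concerns
  finitely many sets, so it is inherited from a single large \<open>n\<close>.\<close>

lemma tail_ultrafilter_exists: "\<exists>p. tail_ultrafilter p"
proof -
  have "\<exists>p :: nat set set \<Rightarrow> bool. \<forall>S N. finite S \<longrightarrow> (\<exists>n\<ge>N. \<forall>A\<in>S. ({n} \<in> A) = p A)"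
  proof (rule pointwise_cluster_point)
    show "({n} \<in> A) \<in> UNIV" for n and A :: "nat set set" by simp
  qed (rule finite)
  then obtain p :: "nat set set \<Rightarrow> bool" where p: "\<forall>S N. finite S \<longrightarrow> (\<exists>n\<ge>N. \<forall>A\<in>S. ({n} \<in> A) = p A)" ..
  have "tail_ultrafilter p"
    unfolding tail_ultrafilter_def
  proof (intro conjI allI)
    fix A B :: "nat set set" and m :: nat
    obtain n where n: "\<forall>C\<in>{A, B, A \<inter> B, - A}. ({n} \<in> C) = p C"
      using p[rule_format, of "{A, B, A \<inter> B, - A}" 0] by (meson finite.intros)
    show "p (A \<inter> B) \<longleftrightarrow> p A \<and> p B"
      using n[rule_format, of A] n[rule_format, of B] n[rule_format, of "A \<inter> B"] by blast
    show "p (- A) \<longleftrightarrow> \<not> p A"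
      using n[rule_format, of A] n[rule_format, of "- A"] by blast
    define T where "T = {\<alpha>. finite \<alpha> \<and> \<alpha> \<noteq> {} \<and> \<alpha> \<subseteq> {m..}}"
    obtain n' where n': "n' \<ge> m" "({n'} \<in> T) = p T"
      using p[rule_format, of "{T}" m] by (meson finite.intros insertI1)
    then have "p T" by (simp add: T_def)
    then show "p {\<alpha>. finite \<alpha> \<and> \<alpha> \<noteq> {} \<and> \<alpha> \<subseteq> {m..}}" by (simp add: T_def)
  qed
  then show ?thesis by blast
qed

text \<open>Each axiom of a tail ultrafilter constrains finitely many Boolean values and is thus
  closed under pointwise convergence, so these ultrafilters form a compact semigroup.\<close>

lemma idempotent_tail_ultrafilter: "\<exists>p. tail_ultrafilter p \<and> ultra_union p p = p"
proof -
  have "\<exists>e\<in>Collect tail_ultrafilter. ultra_union e e = e"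
  proof (rule ellis_numakura[where mul = ultra_union])
    have ev: "continuous_on UNIV (\<lambda>p::nat set set \<Rightarrow> bool. p A)" for A by simp
    have "closed {p. tail_ultrafilter p}"
      unfolding tail_ultrafilter_def
    proof (intro closed_Collect_conj closed_Collect_all)
      have cl: "closed {p::nat set set \<Rightarrow> bool. p A}" for A
        using closed_vimage[OF closed_singleton[of True] ev[of A]] by (simp add: vimage_def)
      have op: "open {p::nat set set \<Rightarrow> bool. p A}" for A
        using open_vimage[OF open_discrete[of "{True}"] ev[of A]] by (simp add: vimage_def)
      have nc: "closed {p::nat set set \<Rightarrow> bool. \<not> p A}" for A
        using op[of A] by (simp add: Collect_neg_eq closed_Compl)
      fix A B :: "nat set set" and m
      have "{p. p (A \<inter> B) = (p A \<and> p B)} =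
        ({p. p (A \<inter> B)} \<inter> {p. p A} \<inter> {p. p B}) \<union> ({p. \<not> p (A \<inter> B)} \<inter> ({p. \<not> p A} \<union> {p. \<not> p B}))" by auto
      then show "closed {p. p (A \<inter> B) = (p A \<and> p B)}" 
        by (simp only:) (intro closed_Int closed_Un cl nc)
      have "{p. p (- A) = (\<not> p A)} = ({p. p (-A)} \<inter> {p. \<not> p A}) \<union> ({p. \<not> p (-A)} \<inter> {p. p A})" by auto
      then show "closed {p. p (- A) = (\<not> p A)}"
        by (simp only:) (intro closed_Int closed_Un cl nc)
      show "closed {p::nat set set \<Rightarrow> bool. p {\<alpha>. finite \<alpha> \<and> \<alpha> \<noteq> {} \<and> \<alpha> \<subseteq> {m..}}}" by (rule cl)
    qed
    moreover have "compact (UNIV :: (nat set set \<Rightarrow> bool) set)"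
    proof -
      have "compactin (product_topology (\<lambda>_::nat set set. euclidean :: bool topology) UNIV) (PiE UNIV (\<lambda>_. UNIV))"
        unfolding compactin_PiE by (simp add: finite_imp_compact)
      then have "compactin (euclidean :: (nat set set \<Rightarrow> bool) topology) (PiE UNIV (\<lambda>_. UNIV))"
        unfolding euclidean_product_topology .
      then show ?thesis by simp
    qed
    ultimately show "compact (Collect tail_ultrafilter)"
      using compact_Int_closed[of UNIV] by simp
    show "Collect tail_ultrafilter \<noteq> {}" using tail_ultrafilter_exists by simp
    show "ultra_union p q \<in> Collect tail_ultrafilter"
      if "p \<in> Collect tail_ultrafilter" "q \<in> Collect tail_ultrafilter" for p q
      using that tail_ultrafilter_union by simp
    show "ultra_union (ultra_union p q) r = ultra_union p (ultra_union q r)" for p q r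
      by (rule ext) (simp add: ultra_union_def Un_assoc)
    show "continuous_on (Collect tail_ultrafilter) (\<lambda>p. ultra_union p q)" for q
      unfolding ultra_union_def
      by (intro continuous_on_coordinatewise_then_product) (rule continuous_on_subset[OF ev subset_UNIV])
  qed
  then show ?thesis by blast
qed

text \<open>The Galvin-Glazer argument. \<open>C'\<close> consists of the members of
  \<open>C\<close> whose union with most sets stays in \<open>C\<close>. Idempotence makes
  \<open>C'\<close> large and makes most unions with a member of \<open>C'\<close> fall into
  \<open>C'\<close> again, so a further block can always be added.\<close>

lemma finite_unions_in_large_set:
  assumes p: "tail_ultrafilter p" "ultra_union p p = p" and C: "p C"
  shows "\<exists>A. (\<forall>i\<in>{1..k::nat}. finite (A i) \<and> A i \<noteq> {} \<and> A i \<subseteq> {1..}) \<and> disjoint_family_on A {1..k} \<and>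
     (\<forall>\<gamma>\<subseteq>{1..k}. \<gamma> \<noteq> {} \<longrightarrow> \<Union>(A ` \<gamma>) \<in> C)"
proof -
  note pD = tail_ultrafilterD[OF p(1)]
  define C' where "C' = {\<alpha> \<in> C. p {\<beta>. \<alpha> \<union> \<beta> \<in> C}}"
  have idem: "p {\<alpha>. p {\<beta>. \<alpha> \<union> \<beta> \<in> D}} \<longleftrightarrow> p D" for D
    using fun_cong[OF p(2), of D] unfolding ultra_union_def .
  have "p C'"
    using C pD(1)[of C "{\<alpha>. p {\<beta>. \<alpha> \<union> \<beta> \<in> C}}"] idem[of C] by (simp add: C'_def Int_def)
  have step: "p {\<beta>. \<alpha> \<union> \<beta> \<in> C'}" if "\<alpha> \<in> C'" for \<alpha>
  proof -
    have "p {\<beta>. p {\<gamma>. \<beta> \<union> \<gamma> \<in> {\<delta>. \<alpha> \<union> \<delta> \<in> C}}}"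
      using that unfolding idem by (simp add: C'_def)
    then have "p ({\<beta>. \<alpha> \<union> \<beta> \<in> C} \<inter> {\<beta>. p {\<gamma>. \<alpha> \<union> \<beta> \<union> \<gamma> \<in> C}})"
      using that unfolding pD(1) by (simp add: C'_def Un_assoc)
    then show ?thesis by (simp add: C'_def Int_def)
  qed
  have "\<exists>A. (\<forall>i\<in>{1..k::nat}. finite (A i) \<and> A i \<noteq> {} \<and> A i \<subseteq> {1..}) \<and> disjoint_family_on A {1..k} \<and>
     (\<forall>\<gamma>\<subseteq>{1..k}. \<gamma> \<noteq> {} \<longrightarrow> \<Union>(A ` \<gamma>) \<in> C')" for k
  proof (induction k)
    case 0
    show ?case by (auto simp: disjoint_family_on_def)
  next
    case (Suc k)
    then obtain A where A: "\<And>i. i \<in> {1..k} \<Longrightarrow> finite (A i) \<and> A i \<noteq> {} \<and> A i \<subseteq> {1..}"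
      "disjoint_family_on A {1..k}" "\<And>\<gamma>. \<gamma> \<subseteq> {1..k} \<Longrightarrow> \<gamma> \<noteq> {} \<Longrightarrow> \<Union>(A ` \<gamma>) \<in> C'"
      by metis
    have "finite (\<Union>(A ` {1..k}))" using A(1) by blast
    then obtain N where N: "\<Union>(A ` {1..k}) \<subseteq> {..<N}" by (meson finite_nat_iff_bounded)
    define \<Gamma> where "\<Gamma> = Pow {1..k} - {{}}"
    have *: "p {\<beta>. \<forall>\<gamma>\<in>\<Gamma>. \<beta> \<in> {\<beta>. \<Union>(A ` \<gamma>) \<union> \<beta> \<in> C'}}"
      by (intro tail_ultrafilter_Inter[OF p(1)] step A) (auto simp: \<Gamma>_def)
    \<comment> \<open>Lying above \<open>N\<close> makes the new block disjoint from the earlier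
      ones. The new block alone is covered by the factor \<open>C'\<close>, its unions with earlier
      blocks by the last factor.\<close>
    define W where "W = C' \<inter> {\<alpha>. finite \<alpha> \<and> \<alpha> \<noteq> {} \<and> \<alpha> \<subseteq> {Suc N..}} \<inter>
        {\<beta>. \<forall>\<gamma>\<in>\<Gamma>. \<beta> \<in> {\<beta>. \<Union>(A ` \<gamma>) \<union> \<beta> \<in> C'}}"
    have "p W"
      unfolding W_def pD(1) using \<open>p C'\<close> pD(3) * by blast
    then have "W \<noteq> {}" using pD(5) by metis
    then obtain \<beta> where "\<beta> \<in> W" by blast
    then have \<beta>: "\<beta> \<in> C'" "finite \<beta>" "\<beta> \<noteq> {}" "\<beta> \<subseteq> {Suc N..}"
      "\<And>\<gamma>. \<gamma> \<in> \<Gamma> \<Longrightarrow> \<Union>(A ` \<gamma>) \<union> \<beta> \<in> C'"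
      by (simp_all add: W_def)
    define A' where "A' = A(Suc k := \<beta>)"
    have A': "A' i = A i" if "i \<le> k" for i using that by (simp add: A'_def)
    have "finite (A' i) \<and> A' i \<noteq> {} \<and> A' i \<subseteq> {1..}" if "i \<in> {1..Suc k}" for i
      using that A(1)[of i] \<beta>(2-4) by (auto simp: A'_def)
    moreover have "disjoint_family_on A' {1..Suc k}"
    proof -
      have A\<beta>: "A i \<inter> \<beta> = {}" if "i \<in> {1..k}" for i
        using that N \<beta>(4) by fastforce
      have "A' m \<inter> A' n = {}" if "m \<in> {1..Suc k}" "n \<in> {1..Suc k}" "m \<noteq> n" for m n
        using that A\<beta>[of m] A\<beta>[of n] A(2)
        by (cases "m = Suc k"; cases "n = Suc k") (simp_all add: A'_def Int_commute disjoint_family_on_def)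
      then show ?thesis by (simp add: disjoint_family_on_def)
    qed
    moreover have "\<Union>(A' ` \<gamma>) \<in> C'" if \<gamma>: "\<gamma> \<subseteq> {1..Suc k}" "\<gamma> \<noteq> {}" for \<gamma>
    proof -
      define \<gamma>' where "\<gamma>' = \<gamma> - {Suc k}"
      have \<gamma>': "\<gamma>' \<subseteq> {1..k}" using \<gamma> by (auto simp: \<gamma>'_def le_Suc_eq)
      then have eq: "\<Union>(A' ` \<gamma>') = \<Union>(A ` \<gamma>')" using A' by (metis (no_types, lifting) SUP_cong atLeastAtMost_iff subsetD)
      show ?thesis
      proof (cases "Suc k \<in> \<gamma>")
        case True
        then have un: "\<Union>(A' ` \<gamma>) = \<Union>(A ` \<gamma>') \<union> \<beta>"
          unfolding eq[symmetric] by (auto simp: \<gamma>'_def A'_def split: if_splits)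
        show ?thesis
        proof (cases "\<gamma>' = {}")
          case True then show ?thesis using un \<beta>(1) by simp
        next
          case False then show ?thesis using un \<beta>(5) \<gamma>' by (simp add: \<Gamma>_def)
        qed
      next
        case False
        then show ?thesis using A(3)[of \<gamma>] eq \<gamma> \<gamma>' unfolding \<gamma>'_def by simp
      qed
    qed
    ultimately show ?case by blast
  qed
  then obtain A where "\<forall>i\<in>{1..k::nat}. finite (A i) \<and> A i \<noteq> {} \<and> A i \<subseteq> {1..}" "disjoint_family_on A {1..k}"
     "\<forall>\<gamma>\<subseteq>{1..k}. \<gamma> \<noteq> {} \<longrightarrow> \<Union>(A ` \<gamma>) \<in> C'"
    by meson
  then show ?thesis by (intro exI[of _ A]) (auto simp: C'_def)
qed

text \<open>Compactness: bad colorings for all \<open>m\<close> would accumulate at one coloring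
  \<open>g\<close> of all sets. One color class of \<open>g\<close> is large for an idempotent
  ultrafilter, and \<open>g\<close> agrees with some bad coloring on the finitely many unions
  involved.\<close>

theorem folkman:
  fixes r k :: nat
  obtains m where "\<And>c::nat set \<Rightarrow> nat. (\<And>\<alpha>. \<alpha> \<subseteq> {1..m} \<Longrightarrow> c \<alpha> < r) \<Longrightarrow>
     \<exists>A j. (\<forall>i\<in>{1..k}. A i \<noteq> {} \<and> A i \<subseteq> {1..m}) \<and> disjoint_family_on A {1..k} \<and>
       (\<forall>\<gamma>\<subseteq>{1..k}. \<gamma> \<noteq> {} \<longrightarrow> c (\<Union>(A ` \<gamma>)) = j)"
proof (rule ccontr)
  define good where "good m c \<longleftrightarrow> (\<exists>A j. (\<forall>i\<in>{1..k}. A i \<noteq> {} \<and> A i \<subseteq> {1..m}) \<and> disjoint_family_on A {1..k} \<and>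
       (\<forall>\<gamma>\<subseteq>{1..k}. \<gamma> \<noteq> {} \<longrightarrow> c (\<Union>(A ` \<gamma>)) = j))" for m and c :: "nat set \<Rightarrow> nat"
  assume "\<not> thesis"
  then have "\<forall>m. \<exists>c::nat set \<Rightarrow> nat. (\<forall>\<alpha>. \<alpha> \<subseteq> {1..m} \<longrightarrow> c \<alpha> < r) \<and> \<not> good m c"
    using that unfolding good_def by metis
  then obtain c :: "nat \<Rightarrow> nat set \<Rightarrow> nat" where c: "\<And>m \<alpha>. \<alpha> \<subseteq> {1..m} \<Longrightarrow> c m \<alpha> < r" "\<And>m. \<not> good m (c m)"
    by metis
  have "r > 0" using c(1)[of "{}"] by fastforce
  obtain g where g: "\<And>S N. finite S \<Longrightarrow> \<exists>n\<ge>N. \<forall>\<alpha>\<in>S. (if \<alpha> \<subseteq> {1..n} then c n \<alpha> else 0) = g \<alpha>"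
  proof -
    have "(if \<alpha> \<subseteq> {1..n} then c n \<alpha> else 0) \<in> {..<r}" for n \<alpha>
      using c(1) \<open>r > 0\<close> by simp
    then show ?thesis
      using that pointwise_cluster_point[of "\<lambda>n \<alpha>. if \<alpha> \<subseteq> {1..n} then c n \<alpha> else 0" "\<lambda>_. {..<r}"]
      by (metis finite_lessThan)
  qed
  have "g \<alpha> < r" for \<alpha>
    using g[of "{\<alpha>}" 0] c(1)[of \<alpha>] \<open>r > 0\<close> by (metis finite.intros insertI1)
  obtain p where p: "tail_ultrafilter p" "ultra_union p p = p"
    using idempotent_tail_ultrafilter by blast
  note pD = tail_ultrafilterD[OF p(1)]
  have "\<exists>j. p {\<alpha>. g \<alpha> = j}"
  proof (rule ccontr)
    assume "\<nexists>j. p {\<alpha>. g \<alpha> = j}"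
    then have "p {\<alpha>. \<forall>j\<in>{..<r}. \<alpha> \<in> - {\<alpha>. g \<alpha> = j}}"
      by (intro tail_ultrafilter_Inter[OF p(1)]) (auto simp: pD(2))
    moreover have "{\<alpha>. \<forall>j\<in>{..<r}. \<alpha> \<in> - {\<alpha>. g \<alpha> = j}} = {}"
      using \<open>\<And>\<alpha>. g \<alpha> < r\<close> by auto
    ultimately show False using pD(5) by (simp only:)
  qed
  then obtain j where "p {\<alpha>. g \<alpha> = j}" ..
  from finite_unions_in_large_set[OF p this, of k] obtain A
    where A: "\<forall>i\<in>{1..k}. finite (A i) \<and> A i \<noteq> {} \<and> A i \<subseteq> {1..}" "disjoint_family_on A {1..k}"
      "\<forall>\<gamma>\<subseteq>{1..k}. \<gamma> \<noteq> {} \<longrightarrow> g (\<Union>(A ` \<gamma>)) = j" unfolding mem_Collect_eq by (elim exE conjE)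
  have "finite (\<Union>(A ` {1..k}))" using A(1) by blast
  then obtain N where N: "\<Union>(A ` {1..k}) \<subseteq> {..<N}" by (meson finite_nat_iff_bounded)
  \<comment> \<open>Agreement is used at some \<open>n \<ge> N\<close> only, where all blocks lie in
    \<open>{1..n}\<close> and the default color 0 does not intervene.\<close>
  obtain n where n: "n \<ge> N" "\<forall>\<gamma>\<in>Pow {1..k}. (if \<Union>(A ` \<gamma>) \<subseteq> {1..n} then c n (\<Union>(A ` \<gamma>)) else 0) = g (\<Union>(A ` \<gamma>))"
    using g[of "(\<lambda>\<gamma>. \<Union>(A ` \<gamma>)) ` Pow {1..k}" N] by auto
  have sub: "A i \<subseteq> {1..n}" if "i \<in> {1..k}" for i
    using that A(1) N n(1) by fastforce
  have "good n (c n)"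
    unfolding good_def
  proof (intro exI[of _ A] exI[of _ j] conjI allI ballI impI)
    fix \<gamma> assume "\<gamma> \<subseteq> {1..k}" "\<gamma> \<noteq> {}"
    moreover from this have "\<Union>(A ` \<gamma>) \<subseteq> {1..n}" using sub by blast
    ultimately show "c n (\<Union>(A ` \<gamma>)) = j" using n(2) A(3) by (metis Pow_iff)
  qed (use A sub in auto)
  then show False using c(2) by blast
qed

section \<open>Actions of abelian groups and finite product sets\<close>

text \<open>Turns approximate position into a color, the form in which Folkman's theorem can be
  applied to orbits.\<close>

lemma finite_coloring_small_diameter:
  fixes K :: "'b::metric_space set"
  assumes "compact K" "e > 0"
  obtains r :: nat and c where "\<And>x. x \<in> K \<Longrightarrow> c x < r"
    "\<And>x y. x \<in> K \<Longrightarrow> y \<in> K \<Longrightarrow> c x = c y \<Longrightarrow> dist x y < e"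
proof -
  have cover: "K \<subseteq> (\<Union>x\<in>K. ball x (e/2))" using assms(2) by auto
  obtain C where C: "finite C" "K \<subseteq> (\<Union>x\<in>C. ball x (e/2))"
    by (rule compactE_image[OF assms(1) _ cover]) (simp, blast)
  obtain f and r :: nat where f: "inj_on f C" "f ` C = {..<r}"
    using finite_imp_inj_to_nat_seg[OF C(1)] unfolding lessThan_def by blast
  obtain n where n: "\<And>x. x \<in> K \<Longrightarrow> n x \<in> C \<and> dist (n x) x < e/2"
  proof -
    have "\<forall>x\<in>K. \<exists>c. c \<in> C \<and> dist c x < e/2"
      using C(2) unfolding subset_iff UN_iff mem_ball by blast
    then show ?thesis using that bchoice[of K "\<lambda>x c. c \<in> C \<and> dist c x < e/2"] by blast
  qed
  show thesis
  proof
    show "f (n x) < r" if "x \<in> K" for x using n[OF that] f(2) by blast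
    show "dist x y < e" if "x \<in> K" "y \<in> K" "f (n x) = f (n y)" for x y
    proof -
      have "n x = n y" using that n f(1) by (meson inj_onD)
      then show ?thesis using n[OF that(1)] n[OF that(2)] dist_triangle_half_r[of "n x" x e y] by simp
    qed
  qed
qed

lemma nested_compact_nonempty:
  fixes K :: "nat \<Rightarrow> 'b::metric_space set"
  assumes "\<And>n. compact (K n)" "\<And>n. K n \<noteq> {}" "\<And>n. K (Suc n) \<subseteq> K n"
  shows "(\<Inter>n. K n) \<noteq> {}"
proof (rule compact_space_imp_nest)
  show "compact_space (top_of_set (K 0))" using assms(1) by (simp add: compact_space_subtopology)
  show dec: "decseq K" using assms(3) by (simp add: decseq_Suc_iff)
  then have "K n \<subseteq> K 0" for n by (simp add: decseqD)
  then show "closedin (top_of_set (K 0)) (K n)" for n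
    using assms(1) by (simp add: closed_subset compact_imp_closed)
qed (use assms in auto)

locale abelian_minimal_system = minimal_system G X \<phi> + comm_group G
  for G :: "('g, 'm) monoid_scheme" (structure)
    and X :: "'a::metric_space set"
    and \<phi> :: "'g \<Rightarrow> 'a \<Rightarrow> 'a"
begin

lemma act_closed [simp]: "g \<in> carrier G \<Longrightarrow> x \<in> X \<Longrightarrow> \<phi> g x \<in> X"
  using element_image by blast

lemma act_mult: "g \<in> carrier G \<Longrightarrow> h \<in> carrier G \<Longrightarrow> x \<in> X \<Longrightarrow> \<phi> (g \<otimes> h) x = \<phi> g (\<phi> h x)"
  using composition_rule by blast

lemma act_one [simp]: "x \<in> X \<Longrightarrow> \<phi> \<one> x = x"
  using id_eq_one by (metis restrict_apply')

lemma act_commute: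
  "g \<in> carrier G \<Longrightarrow> h \<in> carrier G \<Longrightarrow> x \<in> X \<Longrightarrow> \<phi> g (\<phi> h x) = \<phi> h (\<phi> g x)"
  by (metis act_mult m_comm)

lemma act_continuous:
  assumes "g \<in> carrier G"
  shows "continuous_on X (\<phi> g)"
proof -
  have "continuous_map (top_of_set X) (prod_topology (discrete_topology (carrier G)) (top_of_set X)) (\<lambda>x. (g, x))"
    using assms by (intro continuous_map_pairedI) auto
  from continuous_map_compose[OF this continuous_action] show ?thesis
    by (simp add: o_def)
qed

lemma act_uniform:
  assumes "finite S" "S \<subseteq> carrier G" "e > 0"
  shows "\<exists>d>0. \<forall>g\<in>S. \<forall>x\<in>X. \<forall>y\<in>X. dist x y < d \<longrightarrow> dist (\<phi> g x) (\<phi> g y) < e"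
  using assms
proof (induction S)
  case empty
  then show ?case by (intro exI[of _ 1]) auto
next
  case (insert g S)
  then obtain d where d: "d > 0" "\<forall>g\<in>S. \<forall>x\<in>X. \<forall>y\<in>X. dist x y < d \<longrightarrow> dist (\<phi> g x) (\<phi> g y) < e" by auto
  have "uniformly_continuous_on X (\<phi> g)"
    using insert act_continuous compact_uniformly_continuous compact_space by auto
  then obtain d' where d': "d' > 0" "\<forall>x\<in>X. \<forall>y\<in>X. dist x y < d' \<longrightarrow> dist (\<phi> g x) (\<phi> g y) < e"
    using \<open>e > 0\<close> unfolding uniformly_continuous_on_def by (metis dist_commute)
  show ?case
    using d d' by (intro exI[of _ "min d d'"]) auto
qed

lemma act_into_open:
  assumes "finite S" "S \<subseteq> carrier G" "b \<in> X" "openin (top_of_set X) V" "\<And>g. g \<in> S \<Longrightarrow> \<phi> g b \<in> V"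
  shows "\<exists>d>0. \<forall>z\<in>X. dist b z < d \<longrightarrow> (\<forall>g\<in>S. \<phi> g z \<in> V)"
proof (cases "S = {}")
  case False
  have "\<exists>e>0. \<forall>z\<in>X. dist z (\<phi> g b) < e \<longrightarrow> z \<in> V" if "g \<in> S" for g
    using assms(4) assms(5)[OF that] unfolding openin_euclidean_subtopology_iff by blast
  then obtain e where e: "\<And>g. g \<in> S \<Longrightarrow> e g > 0 \<and> (\<forall>z\<in>X. dist z (\<phi> g b) < e g \<longrightarrow> z \<in> V)"
    by metis
  define e' where "e' = Min (e ` S)"
  have "e' > 0" using e assms(1) False by (simp add: e'_def)
  obtain d where d: "d > 0" "\<forall>g\<in>S. \<forall>x\<in>X. \<forall>y\<in>X. dist x y < d \<longrightarrow> dist (\<phi> g x) (\<phi> g y) < e'"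
    using act_uniform[OF assms(1,2) \<open>e' > 0\<close>] by blast
  have "\<phi> g z \<in> V" if "z \<in> X" "dist b z < d" "g \<in> S" for g z
  proof -
    have "dist (\<phi> g b) (\<phi> g z) < e'" using d(2) that assms(3) by blast
    also have "e' \<le> e g" using that(3) assms(1) by (simp add: e'_def)
    finally show ?thesis
      using e[OF that(3)] that assms(2) by (metis act_closed dist_commute subsetD)
  qed
  then show ?thesis using d(1) by blast
qed (use zero_less_one in blast)

text \<open>The points whose orbit misses \<open>V\<close> form a closed invariant set that contains
  no point of \<open>V\<close>, so minimality forces it to be empty.\<close>

lemma dense_orbit:
  assumes "x \<in> X" "openin (top_of_set X) V" "V \<noteq> {}"
  shows "\<exists>g\<in>carrier G. \<phi> g x \<in> V"
proof (rule ccontr)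
  assume "\<not> (\<exists>g\<in>carrier G. \<phi> g x \<in> V)"
  then have no: "\<phi> g x \<notin> V" if "g \<in> carrier G" for g using that by blast
  define A where "A = {y \<in> X. \<forall>g\<in>carrier G. \<phi> g y \<notin> V}"
  have "A = X"
  proof (rule minimal)
    have "closedin (top_of_set X) {y \<in> X. \<phi> g y \<in> X - V}" if "g \<in> carrier G" for g
    proof -
      have "closedin (top_of_set X) (X - V)" using assms(2) by (simp add: closedin_diff)
      from continuous_closedin_preimage_gen[OF act_continuous[OF that] _ this]
      show ?thesis using that by (auto simp: vimage_def Int_def)
    qed
    then have "closedin (top_of_set X) (\<Inter>g\<in>carrier G. {y \<in> X. \<phi> g y \<in> X - V})"
      using one_closed by (intro closedin_INT) auto
    also have "(\<Inter>g\<in>carrier G. {y \<in> X. \<phi> g y \<in> X - V}) = A"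
      using one_closed by (auto simp: A_def)
    finally show "closedin (top_of_set X) A" .
    show "A \<noteq> {}" using no assms(1) by (auto simp: A_def)
    show "\<phi> g ` A \<subseteq> A" if g: "g \<in> carrier G" for g
    proof
      fix y assume "y \<in> \<phi> g ` A"
      then obtain a where a: "a \<in> A" "y = \<phi> g a" by blast
      have "\<phi> h y \<notin> V" if "h \<in> carrier G" for h
      proof -
        have "a \<in> X" "\<phi> (h \<otimes> g) a \<notin> V" using a(1) g that by (simp_all add: A_def)
        then show ?thesis using act_mult[of h g a] g that a(2) by simp
      qed
      moreover have "y \<in> X" using a g by (simp add: A_def)
      ultimately show "y \<in> A" by (simp add: A_def)
    qed
  qed
  moreover obtain v where "v \<in> V" "v \<in> X" using assms(2,3) openin_imp_subset by blast
  ultimately show False using one_closed act_one unfolding A_def by (metis (no_types, lifting) mem_Collect_eq)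
qed

text \<open>Syndeticity of return times: by dense orbits the preimages of \<open>V\<close> cover
  \<open>X\<close>, and a finite subcover suffices.\<close>

lemma finitely_many_translates:
  assumes "openin (top_of_set X) V" "V \<noteq> {}"
  obtains T where "finite T" "T \<subseteq> carrier G" "\<And>x. x \<in> X \<Longrightarrow> \<exists>t\<in>T. \<phi> t x \<in> V"
proof -
  have "\<exists>U. open U \<and> {x \<in> X. \<phi> t x \<in> V} = X \<inter> U" if "t \<in> carrier G" for t
  proof -
    have "openin (top_of_set X) (X \<inter> \<phi> t -` V)"
      using that by (intro continuous_openin_preimage[OF act_continuous _ assms(1)]) auto
    then show ?thesis by (auto simp: openin_open Int_def vimage_def)
  qed
  then obtain U where U: "\<And>t. t \<in> carrier G \<Longrightarrow> open (U t) \<and> {x \<in> X. \<phi> t x \<in> V} = X \<inter> U t" by metis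
  have UV: "x \<in> U t \<longleftrightarrow> \<phi> t x \<in> V" if "t \<in> carrier G" "x \<in> X" for t x
    using U[OF that(1)] that(2) by blast
  have cover: "X \<subseteq> (\<Union>t\<in>carrier G. U t)"
  proof
    fix x assume x: "x \<in> X"
    then obtain t where "t \<in> carrier G" "\<phi> t x \<in> V" using dense_orbit[OF _ assms] by blast
    then show "x \<in> (\<Union>t\<in>carrier G. U t)" using UV x by (intro UN_I[of t]) simp_all
  qed
  obtain T where T: "T \<subseteq> carrier G" "finite T" "X \<subseteq> (\<Union>t\<in>T. U t)"
  proof (rule compactE_image[OF compact_space _ cover])
    show "open (U t)" if "t \<in> carrier G" for t using U[OF that] by (rule conjunct1)
  qed
  have "\<exists>t\<in>T. \<phi> t x \<in> V" if x: "x \<in> X" for x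
  proof -
    obtain t where t: "t \<in> T" "x \<in> U t" using T(3) x by blast
    then have "t \<in> carrier G" using T(1) by blast
    then show ?thesis using UV[of t x] x t by blast
  qed
  then show thesis by (rule that[OF T(2,1)])
qed

text \<open>Commutativity removes the order of the factors, so that products over disjoint blocks of
  indices multiply to products over their unions.\<close>

lemma FP_eq_finprod:
  assumes "p \<in> {1..k} \<rightarrow> carrier G"
  shows "FP G k p = {finprod G p \<alpha> | \<alpha>. \<alpha> \<noteq> {} \<and> \<alpha> \<subseteq> {1..k}}"
proof -
  have *: "foldr (\<otimes>) (map p xs) \<one> = finprod G p (set xs)" if "distinct xs" "p \<in> set xs \<rightarrow> carrier G" for xs
    using that by (induction xs) auto
  have "foldr (\<otimes>) (map p (sorted_list_of_set \<alpha>)) \<one> = finprod G p \<alpha>" if "\<alpha> \<subseteq> {1..k}" for \<alpha>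
  proof -
    have "finite \<alpha>" using that finite_subset by blast
    then show ?thesis using *[of "sorted_list_of_set \<alpha>"] that assms by auto
  qed
  then show ?thesis unfolding FP_def by (intro Collect_cong) (metis (no_types, lifting))
qed

lemma finite_FP: "finite (FP G k p)"
proof -
  have "FP G k p \<subseteq> (\<lambda>\<alpha>. foldr (\<otimes>) (map p (sorted_list_of_set \<alpha>)) \<one>) ` Pow {1..k}"
    by (auto simp: FP_def)
  then show ?thesis by (rule finite_subset) simp
qed

lemma FP_closed:
  assumes "p \<in> {1..k} \<rightarrow> carrier G"
  shows "FP G k p \<subseteq> carrier G"
  unfolding FP_eq_finprod[OF assms] using assms by (auto intro!: finprod_closed)

lemma FP_mono: "k \<le> l \<Longrightarrow> FP G k p \<subseteq> FP G l p"
  unfolding FP_def by fastforce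

lemma FP_Suc:
  assumes "p \<in> {1..Suc k} \<rightarrow> carrier G"
  shows "FP G (Suc k) p = insert (p (Suc k)) (FP G k p \<union> (\<lambda>g. g \<otimes> p (Suc k)) ` FP G k p)"
proof -
  have p: "p \<in> {1..k} \<rightarrow> carrier G" "p (Suc k) \<in> carrier G" using assms by auto
  have ins: "finprod G p (insert (Suc k) \<alpha>) = finprod G p \<alpha> \<otimes> p (Suc k)" if "\<alpha> \<subseteq> {1..k}" for \<alpha>
  proof -
    have "finite \<alpha>" "Suc k \<notin> \<alpha>" "p \<in> \<alpha> \<rightarrow> carrier G" using that p finite_subset by fastforce+
    then show ?thesis using p(2) by (simp add: m_comm)
  qed
  have "g \<in> insert (p (Suc k)) (FP G k p \<union> (\<lambda>g. g \<otimes> p (Suc k)) ` FP G k p)" if g: "g \<in> FP G (Suc k) p" for g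
  proof -
    obtain \<alpha> where \<alpha>: "\<alpha> \<noteq> {}" "\<alpha> \<subseteq> {1..Suc k}" "g = finprod G p \<alpha>"
      using g unfolding FP_eq_finprod[OF assms] by blast
    define \<beta> where "\<beta> = \<alpha> - {Suc k}"
    have \<beta>: "\<beta> \<subseteq> {1..k}" using \<alpha> by (auto simp: \<beta>_def le_Suc_eq)
    show ?thesis
    proof (cases "Suc k \<in> \<alpha>")
      case True
      then have "\<alpha> = insert (Suc k) \<beta>" by (auto simp: \<beta>_def)
      then have "g = finprod G p \<beta> \<otimes> p (Suc k)" using ins[OF \<beta>] \<alpha>(3) by simp
      then show ?thesis using \<beta> p by (cases "\<beta> = {}") (auto simp: FP_eq_finprod)
    next
      case False
      then have "\<alpha> = \<beta>" by (auto simp: \<beta>_def)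
      then show ?thesis using \<alpha> \<beta> p by (auto simp: FP_eq_finprod)
    qed
  qed
  moreover have "p (Suc k) \<in> FP G (Suc k) p"
    unfolding FP_eq_finprod[OF assms] using ins[of "{}"] p(2) by force
  moreover have "g \<otimes> p (Suc k) \<in> FP G (Suc k) p" if "g \<in> FP G k p" for g
  proof -
    obtain \<alpha> where \<alpha>: "\<alpha> \<noteq> {}" "\<alpha> \<subseteq> {1..k}" "g = finprod G p \<alpha>"
      using \<open>g \<in> FP G k p\<close> unfolding FP_eq_finprod[OF p(1)] by blast
    then have "g \<otimes> p (Suc k) = finprod G p (insert (Suc k) \<alpha>)" using ins by simp
    moreover have "insert (Suc k) \<alpha> \<subseteq> {1..Suc k}" using \<alpha> by auto
    ultimately show ?thesis unfolding FP_eq_finprod[OF assms] by blast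
  qed
  ultimately show ?thesis using FP_mono[of k "Suc k" p] by auto
qed

text \<open>A set of indices gets the color of its product, and the block products become the new
  generators. It matters that \<open>m\<close> is chosen before \<open>p\<close>, since an FIP-set
  supplies \<open>p\<close> only once its length is known.\<close>

lemma folkman_FP:
  obtains m where "\<And>p (c :: 'g \<Rightarrow> nat). p \<in> {1..m} \<rightarrow> carrier G \<Longrightarrow> (\<And>g. g \<in> carrier G \<Longrightarrow> c g < r) \<Longrightarrow>
    \<exists>q. q \<in> {1..k} \<rightarrow> carrier G \<and> FP G k q \<subseteq> FP G m p \<and> (\<exists>j. \<forall>g\<in>FP G k q. c g = j)"
proof -
  obtain m where m: "\<And>c::nat set \<Rightarrow> nat. (\<And>\<alpha>. \<alpha> \<subseteq> {1..m} \<Longrightarrow> c \<alpha> < r) \<Longrightarrow>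
     \<exists>A j. (\<forall>i\<in>{1..k}. A i \<noteq> {} \<and> A i \<subseteq> {1..m}) \<and> disjoint_family_on A {1..k} \<and>
       (\<forall>\<gamma>\<subseteq>{1..k}. \<gamma> \<noteq> {} \<longrightarrow> c (\<Union>(A ` \<gamma>)) = j)"
    using folkman[of r k] by metis
  show thesis
  proof
    fix p and c :: "'g \<Rightarrow> nat"
    assume p: "p \<in> {1..m} \<rightarrow> carrier G" and c: "\<And>g. g \<in> carrier G \<Longrightarrow> c g < r"
    have "c (finprod G p \<alpha>) < r" if "\<alpha> \<subseteq> {1..m}" for \<alpha>
      using that p by (intro c finprod_closed) auto
    then obtain A j where A: "\<And>i. i \<in> {1..k} \<Longrightarrow> A i \<noteq> {} \<and> A i \<subseteq> {1..m}" "disjoint_family_on A {1..k}"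
       "\<And>\<gamma>. \<gamma> \<subseteq> {1..k} \<Longrightarrow> \<gamma> \<noteq> {} \<Longrightarrow> c (finprod G p (\<Union>(A ` \<gamma>))) = j"
      using m[of "\<lambda>\<alpha>. c (finprod G p \<alpha>)"] by metis
    define q where "q i = finprod G p (A i)" for i
    have q: "q \<in> {1..k} \<rightarrow> carrier G"
      using A(1) p by (fastforce simp: q_def intro!: finprod_closed)
    have un: "finprod G q \<gamma> = finprod G p (\<Union>(A ` \<gamma>))" if "\<gamma> \<subseteq> {1..k}" for \<gamma>
    proof -
      have "finprod G p (\<Union>(A ` \<gamma>)) = finprod G (\<lambda>i. finprod G p (A i)) \<gamma>"
      proof (rule finprod_UN_disjoint)
        show "finite \<gamma>" using that finite_subset by blast
        show "\<And>i. i \<in> \<gamma> \<Longrightarrow> finite (A i)" using A(1) that by (meson finite_atLeastAtMost finite_subset subsetD)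
        show "pairwise (\<lambda>i j. disjnt (A i) (A j)) \<gamma>"
          using A(2) that by (auto simp: pairwise_def disjnt_def disjoint_family_on_def)
        show "\<And>i x. i \<in> \<gamma> \<Longrightarrow> x \<in> A i \<Longrightarrow> p x \<in> carrier G" using A(1) that p by (metis PiE subsetD)
      qed
      then show ?thesis by (simp add: q_def[abs_def])
    qed
    have "\<exists>\<alpha>. g = finprod G p \<alpha> \<and> \<alpha> \<noteq> {} \<and> \<alpha> \<subseteq> {1..m} \<and> c g = j" if g: "g \<in> FP G k q" for g
    proof -
      obtain \<gamma> where \<gamma>: "\<gamma> \<noteq> {}" "\<gamma> \<subseteq> {1..k}" "g = finprod G q \<gamma>"
        using g unfolding FP_eq_finprod[OF q] by blast
      have "\<Union>(A ` \<gamma>) \<noteq> {}" "\<Union>(A ` \<gamma>) \<subseteq> {1..m}" using A(1) \<gamma> by blast+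
      then show ?thesis using \<gamma> un A(3) by metis
    qed
    then have "FP G k q \<subseteq> FP G m p" "\<forall>g\<in>FP G k q. c g = j"
      unfolding FP_eq_finprod[OF p] by blast+
    then show "\<exists>q. q \<in> {1..k} \<rightarrow> carrier G \<and> FP G k q \<subseteq> FP G m p \<and> (\<exists>j. \<forall>g\<in>FP G k q. c g = j)"
      using q by blast
  qed
qed

end

section \<open>Systems of order infinity are equicontinuous\<close>

lemma (in abelian_minimal_system) FIP_setD:
  assumes "FIP_set G F"
  shows "\<exists>p. p \<in> {1..k} \<rightarrow> carrier G \<and> FP G k p \<subseteq> F"
proof (cases "k \<ge> 1")
  case True
  then show ?thesis using assms unfolding FIP_set_def by blast
next
  case False
  then have "FP G k p \<subseteq> F" for p unfolding FP_def by auto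
  then show ?thesis using False by auto
qed

lemma (in abelian_minimal_system) RP_diagonal: "x \<in> X \<Longrightarrow> (x, x) \<in> RP G X \<phi> k"
proof -
  assume x: "x \<in> X"
  have "(\<lambda>_. \<one>) \<in> {1..k} \<rightarrow> carrier G" by simp
  then show ?thesis
    unfolding RP_def using x by (auto intro!: bexI[of _ x] exI[of _ "\<lambda>_. \<one>"])
qed

text \<open>
  Folkman's theorem moves both points of a separated pair near fixed points \<open>a\<close> and \<open>b\<close> along
  cubes of length \<open>k + 1\<close>; splitting off one generator \<open>t\<close> gives \<open>gy \<approx> gty\<close> for the
  remaining products.
\<close>

lemma (in abelian_minimal_system) separated_pair_cube:
  assumes y: "y \<in> X" and z: "z \<in> X" and F: "FIP_set G F" "\<And>g. g \<in> F \<Longrightarrow> e \<le> dist (\<phi> g y) (\<phi> g z)"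
    and "d > 0"
  shows "\<exists>t p. t \<in> carrier G \<and> e \<le> dist (\<phi> t y) (\<phi> t z) \<and> p \<in> {1..k} \<rightarrow> carrier G \<and>
    (\<forall>g\<in>FP G k p. dist (\<phi> g y) (\<phi> g (\<phi> t y)) < d \<and> dist (\<phi> g z) (\<phi> g (\<phi> t z)) < d)"
proof -
  obtain r :: nat and c where c: "\<And>w. w \<in> X \<times> X \<Longrightarrow> c w < r"
    "\<And>v w. v \<in> X \<times> X \<Longrightarrow> w \<in> X \<times> X \<Longrightarrow> c v = c w \<Longrightarrow> dist v w < d"
    using finite_coloring_small_diameter[OF compact_Times[OF compact_space compact_space] \<open>d > 0\<close>] by metis
  obtain m where m: "\<And>p (c :: 'g \<Rightarrow> nat). p \<in> {1..m} \<rightarrow> carrier G \<Longrightarrow> (\<And>g. g \<in> carrier G \<Longrightarrow> c g < r) \<Longrightarrow>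
    \<exists>q. q \<in> {1..Suc k} \<rightarrow> carrier G \<and> FP G (Suc k) q \<subseteq> FP G m p \<and> (\<exists>j. \<forall>g\<in>FP G (Suc k) q. c g = j)"
    by (fact folkman_FP)
  obtain p where p: "p \<in> {1..m} \<rightarrow> carrier G" "FP G m p \<subseteq> F" using FIP_setD[OF F(1)] by blast
  have "c (\<phi> g y, \<phi> g z) < r" if "g \<in> carrier G" for g using that y z by (intro c(1)) simp
  from m[of p "\<lambda>g. c (\<phi> g y, \<phi> g z)", OF p(1) this]
  obtain q j where q: "q \<in> {1..Suc k} \<rightarrow> carrier G" "FP G (Suc k) q \<subseteq> FP G m p"
    "\<And>g. g \<in> FP G (Suc k) q \<Longrightarrow> c (\<phi> g y, \<phi> g z) = j" by blast
  define t where "t = q (Suc k)"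
  note Suc = FP_Suc[OF q(1), folded t_def]
  have t: "t \<in> carrier G" using q(1) by (auto simp: t_def)
  have q': "q \<in> {1..k} \<rightarrow> carrier G" using q(1) by auto
  have near: "dist (\<phi> g y) (\<phi> g (\<phi> t y)) < d" "dist (\<phi> g z) (\<phi> g (\<phi> t z)) < d" if "g \<in> FP G k q" for g
  proof -
    have g: "g \<in> carrier G" using that FP_closed[OF q'] by blast
    have "g \<in> FP G (Suc k) q" "g \<otimes> t \<in> FP G (Suc k) q" using that unfolding Suc by auto
    then have "c (\<phi> g y, \<phi> g z) = c (\<phi> (g \<otimes> t) y, \<phi> (g \<otimes> t) z)" using q(3) by metis
    then have "dist (\<phi> g y, \<phi> g z) (\<phi> (g \<otimes> t) y, \<phi> (g \<otimes> t) z) < d"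
      using g t y z by (intro c(2)) simp_all
    then show "dist (\<phi> g y) (\<phi> g (\<phi> t y)) < d" "dist (\<phi> g z) (\<phi> g (\<phi> t z)) < d"
      using dist_fst_le[of "(\<phi> g y, \<phi> g z)" "(\<phi> (g \<otimes> t) y, \<phi> (g \<otimes> t) z)"]
        dist_snd_le[of "(\<phi> g y, \<phi> g z)" "(\<phi> (g \<otimes> t) y, \<phi> (g \<otimes> t) z)"] g t y z
      by (simp_all add: act_mult)
  qed
  \<comment> \<open>As a product of one factor, \<open>t\<close> itself lies in \<open>F\<close>;
    the separation at \<open>t\<close> later becomes the separation of the two limits.\<close>
  have "t \<in> F" using Suc q(2) p(2) by blast
  then have "e \<le> dist (\<phi> t y) (\<phi> t z)" by (rule F(2))
  then show ?thesis using t q' near by blast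
qed

lemma (in abelian_minimal_system) order_infinity_imp_equicontinuous:
  assumes ord: "system_of_order_infinity G X \<phi>"
  shows "pairwise_FIP_star_equicontinuous G X \<phi>"
  unfolding pairwise_FIP_star_equicontinuous_def pairwise_FIP_star_equicontinuous_point_def
proof (intro ballI allI impI, rule ccontr)
  fix x and e :: real
  assume x: "x \<in> X" and e: "e > 0" and no: "\<not> (\<exists>U. openin (top_of_set X) U \<and> x \<in> U \<and>
        (\<forall>y\<in>U. \<forall>z\<in>U. FIP_star_set G {g \<in> carrier G. dist (\<phi> g y) (\<phi> g z) < e}))"
  \<comment> \<open>One index \<open>n\<close> controls the closeness to \<open>x\<close>, the
    accuracy and the length of the cube, so a single limit serves every length and
    tolerance.\<close>
  define \<delta> where "\<delta> n = inverse (real (Suc n))" for n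
  have \<delta>: "\<delta> n > 0" for n by (simp add: \<delta>_def)
  have "\<exists>y z t p. y \<in> X \<and> z \<in> X \<and> dist x y < \<delta> n \<and> dist x z < \<delta> n \<and> t \<in> carrier G \<and>
     e \<le> dist (\<phi> t y) (\<phi> t z) \<and> p \<in> {1..n} \<rightarrow> carrier G \<and>
     (\<forall>g\<in>FP G n p. dist (\<phi> g y) (\<phi> g (\<phi> t y)) < \<delta> n \<and> dist (\<phi> g z) (\<phi> g (\<phi> t z)) < \<delta> n)" for n
  proof -
    have "openin (top_of_set X) (X \<inter> ball x (\<delta> n))" "x \<in> X \<inter> ball x (\<delta> n)"
      using x \<delta> by (simp_all add: openin_open_Int)
    then obtain y z where yz: "y \<in> X \<inter> ball x (\<delta> n)" "z \<in> X \<inter> ball x (\<delta> n)"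
      "\<not> FIP_star_set G {g \<in> carrier G. dist (\<phi> g y) (\<phi> g z) < e}" using no by blast
    then obtain F where F: "FIP_set G F" "{g \<in> carrier G. dist (\<phi> g y) (\<phi> g z) < e} \<inter> F = {}"
      unfolding FIP_star_set_def by (metis (no_types, lifting) mem_Collect_eq subsetI)
    have "e \<le> dist (\<phi> g y) (\<phi> g z)" if "g \<in> F" for g
    proof (rule ccontr)
      assume "\<not> e \<le> dist (\<phi> g y) (\<phi> g z)"
      moreover have "g \<in> carrier G" using F(1) that unfolding FIP_set_def by blast
      ultimately have "g \<in> {g \<in> carrier G. dist (\<phi> g y) (\<phi> g z) < e} \<inter> F" using that by simp
      then show False using F(2) by blast
    qed
    from separated_pair_cube[OF _ _ F(1) this \<delta>[of n]] show ?thesis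
      using yz by (intro exI[of _ y] exI[of _ z]) simp
  qed
  then obtain Y Z t p where Y: "\<And>n. Y n \<in> X" "\<And>n. dist x (Y n) < \<delta> n"
    and Z: "\<And>n. Z n \<in> X" "\<And>n. dist x (Z n) < \<delta> n"
    and t: "\<And>n. t n \<in> carrier G" "\<And>n. e \<le> dist (\<phi> (t n) (Y n)) (\<phi> (t n) (Z n))"
    and p: "\<And>n. p n \<in> {1..n} \<rightarrow> carrier G"
     "\<And>n g. g \<in> FP G n (p n) \<Longrightarrow> dist (\<phi> g (Y n)) (\<phi> g (\<phi> (t n) (Y n))) < \<delta> n"
     "\<And>n g. g \<in> FP G n (p n) \<Longrightarrow> dist (\<phi> g (Z n)) (\<phi> g (\<phi> (t n) (Z n))) < \<delta> n"
    by metis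
  define A where "A n = (\<phi> (t n) (Y n), \<phi> (t n) (Z n))" for n
  have "A n \<in> X \<times> X" for n using Y Z t by (simp add: A_def)
  then obtain l r where l: "l \<in> X \<times> X" "strict_mono r" "(A \<circ> r) \<longlonglongrightarrow> l"
    using compact_Times[OF compact_space compact_space] unfolding compact_def by metis
  obtain a b where ab: "l = (a, b)" by fastforce
  have rge: "n \<le> r n" for n using l(2) by (rule strict_mono_imp_increasing)
  \<comment> \<open>Stated for a general sequence, to be used for \<open>Y\<close> and for
    \<open>Z\<close>. The pair approximating \<open>(x, a')\<close> consists of a point
    \<open>W (r n)\<close> and its image under \<open>t (r n)\<close>, with the first
    \<open>k\<close> generators of \<open>p (r n)\<close>.\<close>
  have RPI: "(x, a') \<in> RP_infinity G X \<phi>"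
    if W: "\<And>n. W n \<in> X" "\<And>n. dist x (W n) < \<delta> n"
      "\<And>n g. g \<in> FP G n (p n) \<Longrightarrow> dist (\<phi> g (W n)) (\<phi> g (\<phi> (t n) (W n))) < \<delta> n"
    and lim: "(\<lambda>n. \<phi> (t (r n)) (W (r n))) \<longlonglongrightarrow> a'" and "a' \<in> X" for W a'
  proof -
    have "\<exists>x'\<in>X. \<exists>y'\<in>X. \<exists>p. p \<in> {1..k} \<rightarrow> carrier G \<and> dist x x' < \<eta> \<and>
        dist a' y' < \<eta> \<and> (\<forall>g\<in>FP G k p. dist (\<phi> g x') (\<phi> g y') < \<eta>)" if \<eta>: "\<eta> > 0" for k \<eta>
    proof -
      have "eventually (\<lambda>n. dist (\<phi> (t (r n)) (W (r n))) a' < \<eta>) sequentially"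
        using lim \<eta> by (simp add: tendstoD)
      moreover have "eventually (\<lambda>n. \<delta> n < \<eta>) sequentially"
        using LIMSEQ_inverse_real_of_nat \<eta> unfolding \<delta>_def by (rule order_tendstoD(2))
      moreover have "eventually (\<lambda>n. k \<le> n) sequentially" by (rule eventually_ge_at_top)
      ultimately have "eventually (\<lambda>n. dist (\<phi> (t (r n)) (W (r n))) a' < \<eta> \<and> \<delta> n < \<eta> \<and> k \<le> n) sequentially"
        by eventually_elim simp
      then obtain n where n: "dist (\<phi> (t (r n)) (W (r n))) a' < \<eta>" "\<delta> n < \<eta>" "k \<le> n"
        using eventually_happens' sequentially_bot by blast
      have "\<delta> (r n) \<le> \<delta> n" using rge[of n] by (simp add: \<delta>_def field_simps)
      then have dn: "\<delta> (r n) < \<eta>" using n(2) by simp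
      have "k \<le> r n" using n(3) rge[of n] by simp
      then have sub: "FP G k (p (r n)) \<subseteq> FP G (r n) (p (r n))" "p (r n) \<in> {1..k} \<rightarrow> carrier G"
        using FP_mono p(1)[of "r n"] by auto
      show ?thesis
      proof (intro bexI exI conjI ballI)
        show "dist x (W (r n)) < \<eta>" using W(2)[of "r n"] dn by simp
        show "dist a' (\<phi> (t (r n)) (W (r n))) < \<eta>" using n(1) by (simp add: dist_commute)
        show "dist (\<phi> g (W (r n))) (\<phi> g (\<phi> (t (r n)) (W (r n)))) < \<eta>" if "g \<in> FP G k (p (r n))" for g
          using W(3)[of g "r n"] sub(1) that dn by fastforce
      qed (use sub W t in auto)
    qed
    then show ?thesis
      unfolding RP_infinity_def RP_def using x \<open>a' \<in> X\<close> by simp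
  qed
  have lims: "(\<lambda>n. \<phi> (t (r n)) (Y (r n))) \<longlonglongrightarrow> a" "(\<lambda>n. \<phi> (t (r n)) (Z (r n))) \<longlonglongrightarrow> b"
    using tendsto_fst[OF l(3)] tendsto_snd[OF l(3)] by (simp_all add: ab A_def o_def)
  have "(x, a) \<in> RP_infinity G X \<phi>" "(x, b) \<in> RP_infinity G X \<phi>"
    using RPI[OF Y p(2) lims(1)] RPI[OF Z p(3) lims(2)] l(1) ab by auto
  then have "a = x" "b = x" using ord unfolding system_of_order_infinity_def by auto
  moreover have "e \<le> dist a b"
  proof (rule LIMSEQ_le_const)
    show "(\<lambda>n. dist (\<phi> (t (r n)) (Y (r n))) (\<phi> (t (r n)) (Z (r n)))) \<longlonglongrightarrow> dist a b"
      using lims by (rule tendsto_dist)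
  qed (use t(2) in blast)
  ultimately show False using e by simp
qed

section \<open>Recurrence and separated pairs\<close>

text \<open>
  The minimality of the system replaces an invariant measure here: the orbit of one point is colored
  by the finitely many translates of \<open>V\<close> that cover \<open>X\<close>.
\<close>

lemma (in abelian_minimal_system) recurrence:
  assumes V: "openin (top_of_set X) V" "V \<noteq> {}"
  obtains m where "\<And>p. p \<in> {1..m} \<rightarrow> carrier G \<Longrightarrow>
    \<exists>q b. q \<in> {1..k} \<rightarrow> carrier G \<and> FP G k q \<subseteq> FP G m p \<and> b \<in> V \<and> (\<forall>g\<in>FP G k q. \<phi> g b \<in> V)"
proof -
  obtain T where T: "finite T" "T \<subseteq> carrier G" "\<And>x. x \<in> X \<Longrightarrow> \<exists>t\<in>T. \<phi> t x \<in> V"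
    using finitely_many_translates[OF V] by metis
  obtain f :: "'g \<Rightarrow> nat" and r where f: "inj_on f T" "f ` T = {..<r}"
    using finite_imp_inj_to_nat_seg[OF T(1)] unfolding lessThan_def by blast
  obtain \<tau> where \<tau>: "\<And>x. x \<in> X \<Longrightarrow> \<tau> x \<in> T \<and> \<phi> (\<tau> x) x \<in> V" using T(3) by metis
  obtain w where w: "w \<in> X" using nonempty_space by blast
  obtain m where m: "\<And>p (c :: 'g \<Rightarrow> nat). p \<in> {1..m} \<rightarrow> carrier G \<Longrightarrow> (\<And>g. g \<in> carrier G \<Longrightarrow> c g < r) \<Longrightarrow>
    \<exists>q. q \<in> {1..Suc k} \<rightarrow> carrier G \<and> FP G (Suc k) q \<subseteq> FP G m p \<and> (\<exists>j. \<forall>g\<in>FP G (Suc k) q. c g = j)"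
    by (fact folkman_FP)
  show thesis
  proof
    fix p assume p: "p \<in> {1..m} \<rightarrow> carrier G"
    have "f (\<tau> (\<phi> g w)) < r" if "g \<in> carrier G" for g using \<tau>[of "\<phi> g w"] that w f(2) by auto
    from m[of p "\<lambda>g. f (\<tau> (\<phi> g w))", OF p this]
    obtain q j where q: "q \<in> {1..Suc k} \<rightarrow> carrier G" "FP G (Suc k) q \<subseteq> FP G m p"
      "\<And>g. g \<in> FP G (Suc k) q \<Longrightarrow> f (\<tau> (\<phi> g w)) = j" by blast
    define s where "s = q (Suc k)"
    note Suc = FP_Suc[OF q(1), folded s_def]
    have s: "s \<in> carrier G" using q(1) by (auto simp: s_def)
    have q': "q \<in> {1..k} \<rightarrow> carrier G" using q(1) by auto
    \<comment> \<open>The returning point is \<open>t s w\<close>. All products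
      \<open>g \<otimes> s\<close> have the color of \<open>s\<close>, so the same translate
      \<open>t\<close> brings \<open>g s w\<close> into \<open>V\<close>, and commutativity rewrites
      this as \<open>g\<close> applied to \<open>t s w\<close>.\<close>
    define t where "t = \<tau> (\<phi> s w)"
    have t: "t \<in> T" "t \<in> carrier G" "\<phi> t (\<phi> s w) \<in> V" using \<tau>[of "\<phi> s w"] s w T(2) by (auto simp: t_def)
    have "\<phi> g (\<phi> t (\<phi> s w)) \<in> V" if g: "g \<in> FP G k q" for g
    proof -
      have gc: "g \<in> carrier G" using g FP_closed[OF q'] by blast
      have "s \<in> FP G (Suc k) q" "g \<otimes> s \<in> FP G (Suc k) q" using g unfolding Suc by auto
      then have "f (\<tau> (\<phi> (g \<otimes> s) w)) = f t" using q(3) by (simp add: t_def)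
      then have "\<tau> (\<phi> (g \<otimes> s) w) = t"
        using f(1) t(1) \<tau>[of "\<phi> (g \<otimes> s) w"] gc s w by (simp add: inj_on_def)
      then have "\<phi> t (\<phi> (g \<otimes> s) w) \<in> V" using \<tau>[of "\<phi> (g \<otimes> s) w"] gc s w by simp
      then show ?thesis using act_commute[OF gc t(2), of "\<phi> s w"] gc s w by (simp add: act_mult)
    qed
    moreover have "FP G k q \<subseteq> FP G m p" using Suc q(2) by blast
    ultimately show "\<exists>q b. q \<in> {1..k} \<rightarrow> carrier G \<and> FP G k q \<subseteq> FP G m p \<and> b \<in> V \<and> (\<forall>g\<in>FP G k q. \<phi> g b \<in> V)"
      using q' t(3) by blast
  qed
qed

text \<open>
  Nested sets produce a single pair \<open>(u, v)\<close> that is separated along an FIP-set: \<open>u\<close> is moved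
  away from \<open>x\<close> by the hypothesis on \<open>\<A>\<close>, while \<open>v\<close> returns to \<open>V\<close> by recurrence.
\<close>

lemma (in abelian_minimal_system) separated_along_FIP_set:
  assumes V: "openin (top_of_set X) V" "V \<noteq> {}" "V \<subseteq> ball x \<eta>"
    and A: "A0 \<in> \<A>" "\<And>A. A \<in> \<A> \<Longrightarrow> compact A \<and> A \<noteq> {}"
    and away: "\<And>A k. A \<in> \<A> \<Longrightarrow> \<exists>A'\<in>\<A>. A' \<subseteq> A \<and> (\<exists>p. p \<in> {1..k} \<rightarrow> carrier G \<and>
      (\<forall>g\<in>FP G k p. \<forall>a\<in>A'. 2 * \<eta> \<le> dist (\<phi> g a) x))"
  shows "\<exists>u\<in>A0. \<exists>v\<in>V. \<exists>F. FIP_set G F \<and> (\<forall>g\<in>F. \<eta> \<le> dist (\<phi> g u) (\<phi> g v))"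
proof -
  define P where "P S \<longleftrightarrow> fst S \<in> \<A> \<and> fst S \<subseteq> A0 \<and> openin (top_of_set X) (snd S) \<and> snd S \<noteq> {} \<and> snd S \<subseteq> V" for S
  \<comment> \<open>Keeping the closure of the new open set inside the old one lets the common point
    \<open>v\<close> lie in every open set, not merely in its closure.\<close>
  define Q where "Q n S S' \<longleftrightarrow> fst S' \<subseteq> fst S \<and> X \<inter> closure (snd S') \<subseteq> snd S \<and>
    (\<exists>q. q \<in> {1..n} \<rightarrow> carrier G \<and> (\<forall>g\<in>FP G n q. (\<forall>a\<in>fst S'. 2 * \<eta> \<le> dist (\<phi> g a) x) \<and> (\<forall>b\<in>snd S'. \<phi> g b \<in> snd S)))" for n S S'
  have "\<exists>S'. P S' \<and> Q n S S'" if S: "P S" for n S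
  proof -
    \<comment> \<open>The order of choices matters: recurrence fixes \<open>m\<close>, then
      \<open>away\<close> supplies a sequence of that length, and recurrence thins it to
      \<open>q\<close>. Sub-products still move \<open>A'\<close> away, so one \<open>q\<close>
      serves both sets.\<close>
    obtain m where m: "\<And>p. p \<in> {1..m} \<rightarrow> carrier G \<Longrightarrow>
       \<exists>q b. q \<in> {1..n} \<rightarrow> carrier G \<and> FP G n q \<subseteq> FP G m p \<and> b \<in> snd S \<and> (\<forall>g\<in>FP G n q. \<phi> g b \<in> snd S)"
      using S recurrence[of "snd S" n] unfolding P_def by metis
    obtain A' p where A': "A' \<in> \<A>" "A' \<subseteq> fst S" "p \<in> {1..m} \<rightarrow> carrier G"
      "\<And>g a. g \<in> FP G m p \<Longrightarrow> a \<in> A' \<Longrightarrow> 2 * \<eta> \<le> dist (\<phi> g a) x"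
      using away[of "fst S" m] S unfolding P_def by blast
    obtain q b where q: "q \<in> {1..n} \<rightarrow> carrier G" "FP G n q \<subseteq> FP G m p" "b \<in> snd S" "\<And>g. g \<in> FP G n q \<Longrightarrow> \<phi> g b \<in> snd S"
      using m[OF A'(3)] by blast
    have op: "openin (top_of_set X) (snd S)" using S unfolding P_def by blast
    then have b: "b \<in> X" using q(3) openin_imp_subset by blast
    \<comment> \<open>Including \<open>\<one>\<close> also keeps the ball itself inside
      \<open>snd S\<close>; the half radius below then leaves room for the closure.\<close>
    obtain d where d: "d > 0" "\<And>z g. z \<in> X \<Longrightarrow> dist b z < d \<Longrightarrow> g \<in> insert \<one> (FP G n q) \<Longrightarrow> \<phi> g z \<in> snd S"
      using act_into_open[OF _ _ b op, of "insert \<one> (FP G n q)"] FP_closed[OF q(1)] finite_FP q(3,4) b by force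
    define V' where "V' = X \<inter> ball b (d/2)"
    have cl: "X \<inter> closure V' \<subseteq> snd S"
    proof
      fix z assume z: "z \<in> X \<inter> closure V'"
      have "closure V' \<subseteq> cball b (d/2)" by (rule closure_minimal) (auto simp: V'_def)
      then have "dist b z < d" using z d(1) by auto
      then show "z \<in> snd S" using d(2)[of z \<one>] z by simp
    qed
    have V'S: "V' \<subseteq> snd S" using cl closure_subset[of V'] by (auto simp: V'_def)
    have "P (A', V')"
      unfolding P_def using S A' V'S b d(1) by (auto simp: P_def V'_def openin_open_Int)
    moreover have "Q n S (A', V')"
      unfolding Q_def
    proof (intro conjI exI[of _ q] ballI)
      show "\<phi> g z \<in> snd S" if "g \<in> FP G n q" "z \<in> snd (A', V')" for g z
        using that d by (auto simp: V'_def)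
    qed (use A' q cl in auto)
    ultimately show ?thesis by blast
  qed
  moreover have "P (A0, V)" using A(1) V by (simp add: P_def)
  ultimately obtain S where S: "\<And>n. P (S n)" "\<And>n. Q n (S n) (S (Suc n))"
    using dependent_nat_choice[of "\<lambda>_. P" Q] by blast
  then obtain q where q: "\<And>n. q n \<in> {1..n} \<rightarrow> carrier G"
    "\<And>n g a. g \<in> FP G n (q n) \<Longrightarrow> a \<in> fst (S (Suc n)) \<Longrightarrow> 2 * \<eta> \<le> dist (\<phi> g a) x"
    "\<And>n g b. g \<in> FP G n (q n) \<Longrightarrow> b \<in> snd (S (Suc n)) \<Longrightarrow> \<phi> g b \<in> snd (S n)"
    unfolding Q_def by metis
  have "(\<Inter>n. fst (S n)) \<noteq> {}"
    by (rule nested_compact_nonempty) (use S A(2) in \<open>auto simp: P_def Q_def\<close>)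
  then obtain u where u: "\<And>n. u \<in> fst (S n)" by blast
  have "(\<Inter>n. X \<inter> closure (snd (S n))) \<noteq> {}"
  proof (rule nested_compact_nonempty)
    show "compact (X \<inter> closure (snd (S n)))" for n using compact_space by (simp add: compact_Int_closed)
    show "X \<inter> closure (snd (S n)) \<noteq> {}" for n
    proof -
      have "snd (S n) \<noteq> {}" "snd (S n) \<subseteq> X" using S(1)[of n] openin_imp_subset unfolding P_def by blast+
      then show ?thesis using closure_subset[of "snd (S n)"] by blast
    qed
    show "X \<inter> closure (snd (S (Suc n))) \<subseteq> X \<inter> closure (snd (S n))" for n
      using S(2)[of n] closure_subset[of "snd (S n)"] unfolding Q_def by blast
  qed
  then obtain v where "\<And>n. v \<in> X \<inter> closure (snd (S n))" by blast
  then have v: "v \<in> snd (S n)" for n using S(2)[of n] unfolding Q_def by blast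
  define F where "F = (\<Union>n. FP G n (q n))"
  have "FIP_set G F"
    unfolding FIP_set_def
  proof (intro conjI allI impI)
    show "F \<subseteq> carrier G" unfolding F_def using FP_closed[OF q(1)] by blast
    show "\<exists>p. p \<in> {1..k} \<rightarrow> carrier G \<and> FP G k p \<subseteq> F" for k
      unfolding F_def using q(1)[of k] by (intro exI[of _ "q k"]) blast
  qed
  moreover have "\<eta> \<le> dist (\<phi> g u) (\<phi> g v)" if g: "g \<in> F" for g
  proof -
    obtain n where n: "g \<in> FP G n (q n)" using g unfolding F_def by blast
    \<comment> \<open>Of the distance \<open>2 * \<eta>\<close>, the return of \<open>v\<close> to a
      ball of radius \<eta> costs at most \<eta>.\<close>
    have "2 * \<eta> \<le> dist (\<phi> g u) x" using q(2)[OF n u] .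
    moreover have "dist x (\<phi> g v) < \<eta>" using q(3)[OF n v] S(1)[of n] V(3) unfolding P_def by fastforce
    ultimately show ?thesis using dist_triangle[of "\<phi> g u" x "\<phi> g v"] by (simp add: dist_commute)
  qed
  moreover have "u \<in> A0" "v \<in> V" using u[of 0] v[of 0] S(1)[of 0] unfolding P_def by auto
  ultimately show ?thesis by blast
qed

text \<open>The common end of both halves of the converse. The family \<open>\<A>\<close> is left
  abstract because the proximal case uses one singleton, while the regionally proximal case needs
  sets that shrink.\<close>

lemma (in abelian_minimal_system) equicontinuous_point_not_away:
  assumes eq: "pairwise_FIP_star_equicontinuous_point G X \<phi> x" and x: "x \<in> X" and "\<eta> > 0"
    and away: "\<And>U. openin (top_of_set X) U \<Longrightarrow> x \<in> U \<Longrightarrow> \<exists>A0\<in>\<A>. A0 \<subseteq> U" "\<And>A. A \<in> \<A> \<Longrightarrow> compact A \<and> A \<noteq> {}"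
     "\<And>A k. A \<in> \<A> \<Longrightarrow> \<exists>A'\<in>\<A>. A' \<subseteq> A \<and> (\<exists>p. p \<in> {1..k} \<rightarrow> carrier G \<and>
      (\<forall>g\<in>FP G k p. \<forall>a\<in>A'. 2 * \<eta> \<le> dist (\<phi> g a) x))"
  shows False
proof -
  obtain U where U: "openin (top_of_set X) U" "x \<in> U"
    "\<And>y z. y \<in> U \<Longrightarrow> z \<in> U \<Longrightarrow> FIP_star_set G {g \<in> carrier G. dist (\<phi> g y) (\<phi> g z) < \<eta>}"
    using eq \<open>\<eta> > 0\<close> unfolding pairwise_FIP_star_equicontinuous_point_def by metis
  obtain A0 where A0: "A0 \<in> \<A>" "A0 \<subseteq> U" using away(1)[OF U(1,2)] by blast
  have "openin (top_of_set X) (U \<inter> ball x \<eta>)" using U(1) by (simp add: openin_Int_open)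
  moreover have "U \<inter> ball x \<eta> \<noteq> {}" using U(2) \<open>\<eta> > 0\<close> by force
  ultimately have "\<exists>u\<in>A0. \<exists>v\<in>U \<inter> ball x \<eta>. \<exists>F. FIP_set G F \<and> (\<forall>g\<in>F. \<eta> \<le> dist (\<phi> g u) (\<phi> g v))"
    by (rule separated_along_FIP_set[OF _ _ Int_lower2 A0(1) away(2,3)])
  then obtain u v F where "u \<in> A0" "v \<in> U" "FIP_set G F" "\<forall>g\<in>F. \<eta> \<le> dist (\<phi> g u) (\<phi> g v)" by blast
  then show False using U(3)[of u v] A0(2) unfolding FIP_star_set_def by fastforce
qed

lemma (in abelian_minimal_system) FP_cong:
  assumes "\<And>i. i \<in> {1..k} \<Longrightarrow> p i = q i"
  shows "FP G k p = FP G k q"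
proof -
  have "map p (sorted_list_of_set \<alpha>) = map q (sorted_list_of_set \<alpha>)" if "\<alpha> \<subseteq> {1..k}" for \<alpha>
  proof -
    have "finite \<alpha>" using that finite_subset by blast
    then show ?thesis using that assms by (auto simp: map_eq_conv)
  qed
  then show ?thesis unfolding FP_def by (intro Collect_cong) metis
qed

lemma (in abelian_minimal_system) equicontinuous_imp_distal:
  assumes eq: "pairwise_FIP_star_equicontinuous G X \<phi>" and xy: "x \<in> X" "y \<in> X"
    and prox: "\<And>e. e > 0 \<Longrightarrow> \<exists>g\<in>carrier G. dist (\<phi> g x) (\<phi> g y) < e"
  shows "x = y"
proof (rule ccontr)
  assume "x \<noteq> y"
  \<comment> \<open>A point within \<eta> of \<open>y\<close> is then at distance at least
    \<open>2 * \<eta>\<close> from \<open>x\<close>.\<close>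
  define \<eta> where "\<eta> = dist x y / 3"
  have \<eta>: "\<eta> > 0" using \<open>x \<noteq> y\<close> by (simp add: \<eta>_def)
  \<comment> \<open>Some \<open>g\<close> brings the two points so close together that any of
    finitely many translates keeps them close, and one of these translates returns
    \<open>\<phi> g y\<close> to \<open>y\<close>.\<close>
  have collapse: "\<exists>t\<in>carrier G. dist y (\<phi> t x) < d \<and> dist y (\<phi> t y) < d" if "d > 0" for d
  proof -
    have V: "openin (top_of_set X) (X \<inter> ball y (d/2))" "X \<inter> ball y (d/2) \<noteq> {}"
      using that xy by (auto simp: openin_open_Int)
    obtain T where T: "finite T" "T \<subseteq> carrier G" "\<And>z. z \<in> X \<Longrightarrow> \<exists>t\<in>T. \<phi> t z \<in> X \<inter> ball y (d/2)"
      by (rule finitely_many_translates[OF V]) blast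
    obtain \<delta> where \<delta>: "\<delta> > 0" "\<forall>g\<in>T. \<forall>x\<in>X. \<forall>y\<in>X. dist x y < \<delta> \<longrightarrow> dist (\<phi> g x) (\<phi> g y) < d/2"
      using act_uniform[OF T(1,2), of "d/2"] \<open>d > 0\<close> by auto
    obtain g where g: "g \<in> carrier G" "dist (\<phi> g x) (\<phi> g y) < \<delta>" using prox[OF \<delta>(1)] by blast
    obtain t where t: "t \<in> T" "\<phi> t (\<phi> g y) \<in> X \<inter> ball y (d/2)" using T(3)[of "\<phi> g y"] g xy by auto
    have tc: "t \<in> carrier G" using t(1) T(2) by blast
    have "dist (\<phi> t (\<phi> g x)) (\<phi> t (\<phi> g y)) < d/2" using \<delta>(2) t(1) g xy by simp
    moreover have "dist y (\<phi> t (\<phi> g y)) < d/2" using t(2) by simp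
    ultimately have "dist y (\<phi> t (\<phi> g x)) < d" "dist y (\<phi> t (\<phi> g y)) < d"
      using dist_triangle[of y "\<phi> t (\<phi> g x)" "\<phi> t (\<phi> g y)"] \<open>d > 0\<close> by (simp_all add: dist_commute)
    then show ?thesis using tc g(1) xy by (intro bexI[of _ "t \<otimes> g"]) (simp_all add: act_mult)
  qed
  \<comment> \<open>The point \<open>y\<close> is carried along to make the induction work: the new
    generator moves both points near \<open>y\<close>, where the earlier products act almost as they
    do on \<open>y\<close>, which they keep near \<open>y\<close>.\<close>
  have cube: "\<exists>p. p \<in> {1..k} \<rightarrow> carrier G \<and> (\<forall>g\<in>FP G k p. \<phi> g x \<in> X \<inter> ball y \<eta> \<and> \<phi> g y \<in> X \<inter> ball y \<eta>)" for k
  proof (induction k)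
    case 0
    show ?case by (auto simp: FP_def)
  next
    case (Suc k)
    then obtain p where p: "p \<in> {1..k} \<rightarrow> carrier G"
      "\<And>g. g \<in> FP G k p \<Longrightarrow> \<phi> g x \<in> X \<inter> ball y \<eta> \<and> \<phi> g y \<in> X \<inter> ball y \<eta>" by blast
    have op: "openin (top_of_set X) (X \<inter> ball y \<eta>)" by (simp add: openin_open_Int)
    have "finite (insert \<one> (FP G k p))" "insert \<one> (FP G k p) \<subseteq> carrier G"
      using finite_FP FP_closed[OF p(1)] by auto
    moreover have "\<phi> g y \<in> X \<inter> ball y \<eta>" if "g \<in> insert \<one> (FP G k p)" for g
      using that p(2) xy \<eta> by auto
    ultimately obtain d where d: "d > 0"
      "\<forall>z\<in>X. dist y z < d \<longrightarrow> (\<forall>g\<in>insert \<one> (FP G k p). \<phi> g z \<in> X \<inter> ball y \<eta>)"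
      using act_into_open[OF _ _ xy(2) op, of "insert \<one> (FP G k p)"] by blast
    obtain t where t: "t \<in> carrier G" "dist y (\<phi> t x) < d" "dist y (\<phi> t y) < d" using collapse[OF d(1)] by blast
    define p' where "p' = p(Suc k := t)"
    have p': "p' \<in> {1..Suc k} \<rightarrow> carrier G" using p(1) t(1) by (auto simp: p'_def le_Suc_eq)
    have "FP G k p' = FP G k p" by (rule FP_cong) (simp add: p'_def)
    then have Suc': "FP G (Suc k) p' = insert t (FP G k p \<union> (\<lambda>g. g \<otimes> t) ` FP G k p)"
      using FP_Suc[OF p'] by (simp add: p'_def)
    have t': "\<phi> g (\<phi> t x) \<in> X \<inter> ball y \<eta> \<and> \<phi> g (\<phi> t y) \<in> X \<inter> ball y \<eta>" if "g \<in> insert \<one> (FP G k p)" for g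
      using d(2) t xy that by (meson act_closed)
    have "\<phi> g x \<in> X \<inter> ball y \<eta> \<and> \<phi> g y \<in> X \<inter> ball y \<eta>" if g: "g \<in> FP G (Suc k) p'" for g
    proof -
      consider "g = t" | "g \<in> FP G k p" | h where "h \<in> FP G k p" "g = h \<otimes> t"
        using g unfolding Suc' by blast
      then show ?thesis
      proof cases
        case 1 then show ?thesis using t'[of \<one>] t xy by simp
      next
        case 2 then show ?thesis using p(2) by simp
      next
        case 3
        moreover from this have "h \<in> carrier G" using FP_closed[OF p(1)] by blast
        ultimately show ?thesis using t'[of h] t xy by (simp add: act_mult)
      qed
    qed
    then show ?case using p' by blast
  qed
  show False
  proof (rule equicontinuous_point_not_away[where \<A> = "{{x}}" and x = x and \<eta> = \<eta>])
    show "pairwise_FIP_star_equicontinuous_point G X \<phi> x"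
      using eq xy unfolding pairwise_FIP_star_equicontinuous_def by blast
    show "\<exists>A'\<in>{{x}}. A' \<subseteq> A \<and> (\<exists>p. p \<in> {1..k} \<rightarrow> carrier G \<and> (\<forall>g\<in>FP G k p. \<forall>a\<in>A'. 2 * \<eta> \<le> dist (\<phi> g a) x))"
      if "A \<in> {{x}}" for A k
    proof -
      obtain p where p: "p \<in> {1..k} \<rightarrow> carrier G" "\<And>g. g \<in> FP G k p \<Longrightarrow> dist y (\<phi> g x) < \<eta>"
        using cube[of k] by auto
      have "2 * \<eta> \<le> dist (\<phi> g x) x" if "g \<in> FP G k p" for g
        using p(2)[OF that] dist_triangle[of x y "\<phi> g x"] by (simp add: \<eta>_def dist_commute)
      then show ?thesis using \<open>A \<in> {{x}}\<close> p(1) by auto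
    qed
  qed (use xy \<eta> in auto)
qed

section \<open>Minimality in powers of distal systems\<close>

text \<open>Membership of \<open>w\<close> in the orbit closure of \<open>z\<close> in the power of
  \<open>X\<close> over \<open>I\<close>, with each coordinate acted on by its own group
  element.\<close>

definition (in abelian_minimal_system) reach :: "('i \<Rightarrow> 'g) set \<Rightarrow> 'i set \<Rightarrow> ('i \<Rightarrow> 'a) \<Rightarrow> ('i \<Rightarrow> 'a) \<Rightarrow> bool" where
  "reach H I z w \<longleftrightarrow> (\<forall>e>0. \<exists>h\<in>H. \<forall>i\<in>I. dist (\<phi> (h i) (z i)) (w i) < e)"

locale distal_system = abelian_minimal_system G X \<phi>
  for G :: "('g, 'm) monoid_scheme" (structure)
    and X :: "'a::metric_space set"
    and \<phi> :: "'g \<Rightarrow> 'a \<Rightarrow> 'a" +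
  assumes distal: "\<And>x y. x \<in> X \<Longrightarrow> y \<in> X \<Longrightarrow> (\<And>e. e > 0 \<Longrightarrow> \<exists>g\<in>carrier G. dist (\<phi> g x) (\<phi> g y) < e) \<Longrightarrow> x = y"

text \<open>
  If \<open>w = p z\<close> for \<open>p\<close> in the enveloping semigroup \<open>S\<close>, an idempotent \<open>u = q p\<close> of the left ideal
  \<open>S p\<close> has \<open>u (u z) = u z\<close>; so \<open>u z\<close> and \<open>z\<close> are proximal in every coordinate, and distality gives
  \<open>z = u z = q w\<close>.
\<close>

lemma (in distal_system) reach_sym:
  fixes H :: "('i \<Rightarrow> 'g) set"
  assumes I: "finite I" and HG: "\<And>h i. h \<in> H \<Longrightarrow> i \<in> I \<Longrightarrow> h i \<in> carrier G"
    and Hm: "\<And>h k. h \<in> H \<Longrightarrow> k \<in> H \<Longrightarrow> (\<lambda>i. h i \<otimes> k i) \<in> H"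
    and z: "z \<in> I \<rightarrow> X" and w: "w \<in> I \<rightarrow> X" and zw: "reach H I z w"
  shows "reach H I w z"
proof -
  \<comment> \<open>A coordinatewise transformation of the power is a family of self-maps of
    \<open>X\<close>, encoded as one function of \<open>(i, x)\<close>. The identity values
    elsewhere confine these functions to a compact product.\<close>
  define act where "act h = (\<lambda>(i, x). if i \<in> I \<and> x \<in> X then \<phi> (h i) x else x)" for h :: "'i \<Rightarrow> 'g"
  define C where "C = (\<lambda>(i, x). if i \<in> I \<and> x \<in> X then X else {x})"
  define K where "K = PiE UNIV C"
  have Kin: "q (i, x) \<in> X" if "q \<in> K" "i \<in> I" "x \<in> X" for q i x
    using that PiE_mem[of q UNIV C "(i, x)"] by (simp add: K_def C_def)
  have Kout: "q (i, x) = x" if "q \<in> K" "\<not> (i \<in> I \<and> x \<in> X)" for q i x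
    using that PiE_mem[of q UNIV C "(i, x)"] by (auto simp: K_def C_def)
  have "compactin (product_topology (\<lambda>_. euclidean) UNIV) K"
    unfolding K_def compactin_PiE using compact_space by (auto simp: C_def)
  then have K: "compact K"
    unfolding euclidean_product_topology by simp
  define S where "S = closure (act ` H)"
  have actK: "act h \<in> K" if "h \<in> H" for h
    using HG[OF that] by (auto simp: K_def C_def act_def)
  have SK: "S \<subseteq> K"
    unfolding S_def using actK compact_imp_closed_fun[OF K] by (intro closure_minimal) auto
  have S: "compact S"
    using compact_Int_closed[OF K, of S] SK by (simp add: S_def Int_absorb1)
  have ev: "continuous_on A (\<lambda>q. q j)" for A and j :: "'i \<times> 'a"
    using continuous_on_subset[OF continuous_on_product_coordinates] by auto
  define mul where "mul p q = (\<lambda>(i, x). p (i, q (i, x)))" for p q :: "'i \<times> 'a \<Rightarrow> 'a"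
  have cont_left: "continuous_on A (\<lambda>p. mul p q)" for A q
    unfolding mul_def
    by (intro continuous_on_coordinatewise_then_product) (auto simp: split_def ev)
  have cont_right: "continuous_on S (mul (act h))" if h: "h \<in> H" for h
  proof (rule continuous_on_coordinatewise_then_product)
    fix j :: "'i \<times> 'a"
    obtain i x where j: "j = (i, x)" by fastforce
    show "continuous_on S (\<lambda>q. mul (act h) q j)"
    proof (cases "i \<in> I \<and> x \<in> X")
      case True
      have "continuous_on S (\<lambda>q. \<phi> (h i) (q (i, x)))"
        by (rule continuous_on_compose2[OF act_continuous ev]) (use True HG h SK Kin in auto)
      moreover have "mul (act h) q j = \<phi> (h i) (q (i, x))" if "q \<in> S" for q
        using True Kin that SK by (auto simp: mul_def act_def j)
      ultimately show ?thesis by (simp cong: continuous_on_cong)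
    next
      case False
      then have "mul (act h) q j = x" if "q \<in> S" for q
        using Kout[of q i x] that SK by (auto simp: mul_def act_def j)
      then show ?thesis by (simp cong: continuous_on_cong)
    qed
  qed
  have mul_act: "mul (act h) (act k) = act (\<lambda>i. h i \<otimes> k i)" if "h \<in> H" "k \<in> H" for h k
    using HG that by (auto simp: mul_def act_def fun_eq_iff act_mult)
  \<comment> \<open>Closure under products takes two limits: first in the right factor with
    \<open>act h\<close> fixed, by continuity of the action, then in the left factor, where
    multiplication is mere evaluation.\<close>
  have step: "mul (act h) q \<in> S" if "h \<in> H" "q \<in> S" for h q
  proof -
    have "mul (act h) ` (act ` H) \<subseteq> S"
      using mul_act[OF that(1)] Hm[OF that(1)] closure_subset[of "act ` H"] by (auto simp: S_def)
    then have "mul (act h) ` S \<subseteq> S"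
      unfolding S_def using cont_right[OF that(1)] by (intro image_closure_subset) (auto simp: S_def)
    then show ?thesis using that(2) by blast
  qed
  have mulS: "mul p q \<in> S" if "p \<in> S" "q \<in> S" for p q
  proof -
    have "(\<lambda>p. mul p q) ` (act ` H) \<subseteq> S" using step that by auto
    then have "(\<lambda>p. mul p q) ` S \<subseteq> S"
      unfolding S_def using cont_left by (intro image_closure_subset) auto
    then show ?thesis using that(1) by blast
  qed
  have assoc: "mul (mul p q) r = mul p (mul q r)" for p q r
    by (simp add: mul_def fun_eq_iff)
  have approx: "\<exists>h\<in>H. \<forall>(i, x)\<in>J. dist (\<phi> (h i) x) (p (i, x)) < e"
    if p: "p \<in> S" and J: "finite J" "J \<subseteq> I \<times> X" and e: "e > 0" for p J e
  proof -
    have "open {f :: 'i \<times> 'a \<Rightarrow> 'a. dist (f j) (p j) < e}" for j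
      by (intro open_Collect_less continuous_intros ev)
    then have "open (\<Inter>j\<in>J. {f. dist (f j) (p j) < e})" using J(1) by blast
    moreover have "p \<in> (\<Inter>j\<in>J. {f. dist (f j) (p j) < e})" using e by simp
    ultimately have "(\<Inter>j\<in>J. {f. dist (f j) (p j) < e}) \<inter> act ` H \<noteq> {}"
      using p open_Int_closure_eq_empty unfolding S_def by blast
    then obtain h where h: "h \<in> H" "\<And>j. j \<in> J \<Longrightarrow> dist (act h j) (p j) < e" by auto
    have "dist (\<phi> (h i) x) (p (i, x)) < e" if "(i, x) \<in> J" for i x
    proof -
      have "i \<in> I" "x \<in> X" using that J(2) by auto
      then show ?thesis using h(2)[OF that] by (simp add: act_def)
    qed
    then show ?thesis using h(1) by blast
  qed
  \<comment> \<open>Compactness replaces the approximations in \<open>reach\<close> by one element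
    \<open>p\<close> of the semigroup with \<open>p z = w\<close> exactly.\<close>
  define T where "T n = {p \<in> S. \<forall>i\<in>I. dist (p (i, z i)) (w i) \<le> inverse (real (Suc n))}" for n
  have "(\<Inter>n. T n) \<noteq> {}"
  proof (rule compact_space_imp_nest)
    show "compact_space (top_of_set S)" using S by (simp add: compact_space_subtopology)
    show "closedin (top_of_set S) (T n)" for n
    proof -
      have "closed {p :: 'i \<times> 'a \<Rightarrow> 'a. dist (p (i, z i)) (w i) \<le> inverse (real (Suc n))}" for i
        by (intro closed_Collect_le continuous_intros ev)
      then have "closed (\<Inter>i\<in>I. {p. dist (p (i, z i)) (w i) \<le> inverse (real (Suc n))})" by blast
      moreover have "T n = S \<inter> (\<Inter>i\<in>I. {p. dist (p (i, z i)) (w i) \<le> inverse (real (Suc n))})"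
        by (auto simp: T_def)
      ultimately show ?thesis by (simp add: closedin_closed_Int)
    qed
    show "T n \<noteq> {}" for n
    proof -
      obtain h where h: "h \<in> H" "\<forall>i\<in>I. dist (\<phi> (h i) (z i)) (w i) < inverse (real (Suc n))"
        using zw unfolding reach_def by (metis inverse_positive_iff_positive of_nat_0_less_iff zero_less_Suc)
      then have "act h \<in> S" using closure_subset[of "act ` H"] by (auto simp: S_def)
      moreover have "act h (i, z i) = \<phi> (h i) (z i)" if "i \<in> I" for i
        using that z by (auto simp: act_def)
      ultimately have "act h \<in> T n" using h(2) by (auto simp: T_def less_imp_le)
      then show ?thesis by blast
    qed
    have "inverse (real (Suc n)) \<le> inverse (real (Suc m))" if "m \<le> n" for m n
      using that by (simp add: field_simps)
    then show "decseq T"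
      unfolding decseq_def T_def by (auto intro: order_trans)
  qed
  then obtain p where p: "\<And>n. p \<in> T n" by blast
  have pz: "p (i, z i) = w i" if "i \<in> I" for i
  proof -
    have "dist (p (i, z i)) (w i) \<le> inverse (real (Suc n))" for n
      using p[of n] that by (simp add: T_def)
    then have "dist (p (i, z i)) (w i) \<le> 0"
      using LIMSEQ_le_const[OF LIMSEQ_inverse_real_of_nat] by blast
    then show ?thesis by simp
  qed
  have pS: "p \<in> S" using p[of 0] by (simp add: T_def)
  define L where "L = (\<lambda>q. mul q p) ` S"
  have LS: "L \<subseteq> S" using mulS pS by (auto simp: L_def)
  have "\<exists>u\<in>L. mul u u = u"
  proof (rule ellis_numakura[where mul = mul])
    show "compact L" unfolding L_def using cont_left S by (rule compact_continuous_image)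
    show "L \<noteq> {}" using pS by (auto simp: L_def)
    show "mul q r \<in> L" if q: "q \<in> L" and r: "r \<in> L" for q r
    proof -
      obtain r' where "r' \<in> S" "r = mul r' p" using r by (auto simp: L_def)
      then have "mul q r = mul (mul q r') p" "mul q r' \<in> S"
        using assoc mulS q LS by auto
      then show ?thesis by (auto simp: L_def)
    qed
  qed (use assoc cont_left in auto)
  then obtain u q where u: "u \<in> S" "mul u u = u" "q \<in> S" "u = mul q p" using LS by (auto simp: L_def)
  have qw: "q (i, w i) = z i" if i: "i \<in> I" for i
  proof -
    have zi: "z i \<in> X" using z i by blast
    have uX: "u (i, z i) \<in> X" using Kin u(1) SK i zi by blast
    have uu: "u (i, u (i, z i)) = u (i, z i)" using fun_cong[OF u(2), of "(i, z i)"] by (simp add: mul_def)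
    \<comment> \<open>As \<open>u\<close> sends both points to \<open>u (i, z i)\<close>, a group
      element approximating \<open>u\<close> at these two points brings them close together.\<close>
    have "u (i, z i) = z i"
    proof (rule distal[OF uX zi])
      fix e :: real assume "e > 0"
      obtain h where h: "h \<in> H" "\<forall>(i, x)\<in>{(i, z i), (i, u (i, z i))}. dist (\<phi> (h i) x) (u (i, x)) < e/2"
        using approx[OF u(1), of "{(i, z i), (i, u (i, z i))}" "e/2"] i zi uX \<open>e > 0\<close> by auto
      then have "dist (\<phi> (h i) (z i)) (u (i, z i)) < e/2" "dist (\<phi> (h i) (u (i, z i))) (u (i, z i)) < e/2"
        using uu by auto
      then have "dist (\<phi> (h i) (u (i, z i))) (\<phi> (h i) (z i)) < e"
        using dist_triangle_half_l by blast
      then show "\<exists>g\<in>carrier G. dist (\<phi> g (u (i, z i))) (\<phi> g (z i)) < e" using HG[OF h(1) i] by blast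
    qed
    moreover have "u (i, z i) = q (i, w i)" using pz[OF i] by (simp add: u(4) mul_def)
    ultimately show ?thesis by simp
  qed
  show ?thesis
    unfolding reach_def
  proof (intro allI impI)
    fix e :: real assume "e > 0"
    obtain h where h: "h \<in> H" "\<forall>(i, x)\<in>(\<lambda>i. (i, w i)) ` I. dist (\<phi> (h i) x) (q (i, x)) < e"
      using approx[OF u(3), of "(\<lambda>i. (i, w i)) ` I" e] I w \<open>e > 0\<close> by auto
    then show "\<exists>h\<in>H. \<forall>i\<in>I. dist (\<phi> (h i) (w i)) (z i) < e" using qw by (intro bexI[of _ h]) auto
  qed
qed

section \<open>Gluing of cubes\<close>

lemma finite_family_convergent_subsequence:
  fixes u :: "nat \<Rightarrow> 'i \<Rightarrow> 'b::metric_space"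
  assumes "finite A" "compact K" "\<And>n a. a \<in> A \<Longrightarrow> u n a \<in> K"
  shows "\<exists>r l. strict_mono (r :: nat \<Rightarrow> nat) \<and> (\<forall>a\<in>A. l a \<in> K \<and> (\<lambda>n. u (r n) a) \<longlonglongrightarrow> l a)"
  using assms(1,3)
proof (induction A)
  case empty
  then show ?case by (auto intro: strict_mono_id)
next
  case (insert a A)
  then obtain r l where r: "strict_mono (r :: nat \<Rightarrow> nat)" "\<forall>b\<in>A. l b \<in> K \<and> (\<lambda>n. u (r n) b) \<longlonglongrightarrow> l b"
    by auto
  have "\<forall>n. u (r n) a \<in> K" using insert.prems by blast
  then obtain m s where s: "m \<in> K" "strict_mono s" "((\<lambda>n. u (r n) a) \<circ> s) \<longlonglongrightarrow> m"
    using assms(2) unfolding compact_def by meson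
  have "(\<lambda>n. u (r (s n)) b) \<longlonglongrightarrow> l b" if "b \<in> A" for b
    using LIMSEQ_subseq_LIMSEQ[OF _ s(2), of "\<lambda>n. u (r n) b" "l b"] r(2) that by (simp add: o_def)
  then show ?case
    using r s insert.hyps(2) strict_mono_o[OF r(1) s(2)]
    by (intro exI[of _ "r \<circ> s"] exI[of _ "l(a := m)"]) (auto simp: o_def)
qed

text \<open>
  The Host--Kra group of the cube \<open>Pow I\<close>: \<open>g\<close> acts diagonally and \<open>p i\<close> on the upper
  face of the sets containing \<open>i\<close>. Values outside \<open>Pow I\<close> are irrelevant.
\<close>

definition (in abelian_minimal_system) cube_group :: "nat set \<Rightarrow> (nat set \<Rightarrow> 'g) set" where
  "cube_group I = {h. \<exists>g\<in>carrier G. \<exists>p\<in>I \<rightarrow> carrier G. \<forall>\<alpha>. \<alpha> \<subseteq> I \<longrightarrow> h \<alpha> = g \<otimes> finprod G p \<alpha>}"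

text \<open>The Host-Kra cubes, described without a base point. In a distal system, for finite
  \<open>I\<close>, this amounts to lying in the orbit closure of any given constant. In this form
  the property passes backwards along \<open>reach\<close> even without distality.\<close>

definition (in abelian_minimal_system) near_diagonal :: "nat set \<Rightarrow> (nat set \<Rightarrow> 'a) \<Rightarrow> bool" where
  "near_diagonal I z \<longleftrightarrow> (\<forall>e>0. \<exists>h\<in>cube_group I. \<forall>\<alpha> \<beta>. \<alpha> \<subseteq> I \<longrightarrow> \<beta> \<subseteq> I \<longrightarrow>
     dist (\<phi> (h \<alpha>) (z \<alpha>)) (\<phi> (h \<beta>) (z \<beta>)) < e)"

lemma (in abelian_minimal_system) cube_group_closed:
  assumes "h \<in> cube_group I" "\<alpha> \<subseteq> I"
  shows "h \<alpha> \<in> carrier G"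
proof -
  obtain g p where "g \<in> carrier G" "p \<in> I \<rightarrow> carrier G" "h \<alpha> = g \<otimes> finprod G p \<alpha>"
    using assms by (auto simp: cube_group_def)
  moreover from this have "finprod G p \<alpha> \<in> carrier G" using assms(2) by (intro finprod_closed) auto
  ultimately show ?thesis by simp
qed

lemma (in abelian_minimal_system) cube_group_mult:
  assumes "h \<in> cube_group I" "k \<in> cube_group I"
  shows "(\<lambda>\<alpha>. h \<alpha> \<otimes> k \<alpha>) \<in> cube_group I"
proof -
  obtain g p where g: "g \<in> carrier G" "p \<in> I \<rightarrow> carrier G" "\<And>\<alpha>. \<alpha> \<subseteq> I \<Longrightarrow> h \<alpha> = g \<otimes> finprod G p \<alpha>"
    using assms(1) by (auto simp: cube_group_def)
  obtain g' p' where g': "g' \<in> carrier G" "p' \<in> I \<rightarrow> carrier G" "\<And>\<alpha>. \<alpha> \<subseteq> I \<Longrightarrow> k \<alpha> = g' \<otimes> finprod G p' \<alpha>"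
    using assms(2) by (auto simp: cube_group_def)
  have "h \<alpha> \<otimes> k \<alpha> = (g \<otimes> g') \<otimes> finprod G (\<lambda>i. p i \<otimes> p' i) \<alpha>" if "\<alpha> \<subseteq> I" for \<alpha>
  proof -
    have p: "p \<in> \<alpha> \<rightarrow> carrier G" "p' \<in> \<alpha> \<rightarrow> carrier G" using g(2) g'(2) that by auto
    then have "finprod G (\<lambda>i. p i \<otimes> p' i) \<alpha> = finprod G p \<alpha> \<otimes> finprod G p' \<alpha>" by (rule finprod_multf)
    then show ?thesis using g(1,3) g'(1,3) that p by (simp add: m_ac finprod_closed)
  qed
  moreover have "(\<lambda>i. p i \<otimes> p' i) \<in> I \<rightarrow> carrier G" using g(2) g'(2) by auto
  ultimately show ?thesis
    using g(1) g'(1) unfolding cube_group_def by blast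
qed

lemma (in abelian_minimal_system) cube_group_translate:
  assumes "t \<in> carrier G"
  shows "(\<lambda>_. t) \<in> cube_group I"
  using assms unfolding cube_group_def
  by (intro CollectI bexI[of _ t] bexI[of _ "\<lambda>_. \<one>"]) auto

lemma (in abelian_minimal_system) finprod_update:
  assumes "finite \<alpha>" "p \<in> \<alpha> \<rightarrow> carrier G" "c \<in> carrier G"
  shows "finprod G (p(j := c)) \<alpha> = (if j \<in> \<alpha> then c \<otimes> finprod G p (\<alpha> - {j}) else finprod G p \<alpha>)"
proof -
  have eq: "finprod G (p(j := c)) \<beta> = finprod G p \<beta>" if "j \<notin> \<beta>" "\<beta> \<subseteq> \<alpha>" for \<beta>
    using that assms(2) by (intro finprod_cong') auto
  show ?thesis
  proof (cases "j \<in> \<alpha>")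
    case True
    then have "finprod G (p(j := c)) \<alpha> = finprod G (p(j := c)) (insert j (\<alpha> - {j}))" by (simp add: insert_absorb)
    also have "\<dots> = c \<otimes> finprod G (p(j := c)) (\<alpha> - {j})"
      by (subst finprod_insert) (use assms in auto)
    finally show ?thesis using True eq[of "\<alpha> - {j}"] by simp
  qed (use eq in simp)
qed

definition flip :: "nat \<Rightarrow> nat set \<Rightarrow> nat set" where
  "flip i \<alpha> = (if i \<in> \<alpha> then \<alpha> - {i} else insert i \<alpha>)"

text \<open>Replacing the generator \<open>p j\<close> by \<open>\<one>\<close> makes direction
  \<open>j\<close> degenerate.\<close>

lemma (in abelian_minimal_system) cube_group_remove:
  assumes "finite I" "h \<in> cube_group I"
  shows "(\<lambda>\<alpha>. h (\<alpha> - {j})) \<in> cube_group I"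
proof -
  obtain g p where g: "g \<in> carrier G" "p \<in> I \<rightarrow> carrier G" "\<And>\<alpha>. \<alpha> \<subseteq> I \<Longrightarrow> h \<alpha> = g \<otimes> finprod G p \<alpha>"
    using assms(2) by (auto simp: cube_group_def)
  have "h (\<alpha> - {j}) = g \<otimes> finprod G (p(j := \<one>)) \<alpha>" if "\<alpha> \<subseteq> I" for \<alpha>
  proof -
    have "finite \<alpha>" "p \<in> \<alpha> \<rightarrow> carrier G" using assms(1) g(2) that finite_subset by blast+
    moreover have "finprod G p (\<alpha> - {j}) \<in> carrier G" using g(2) that by (intro finprod_closed) auto
    moreover have "h (\<alpha> - {j}) = g \<otimes> finprod G p (\<alpha> - {j})" using that by (intro g(3)) auto
    ultimately show ?thesis by (simp add: finprod_update)
  qed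
  moreover have "p(j := \<one>) \<in> I \<rightarrow> carrier G" using g(2) by auto
  ultimately show ?thesis using g(1) unfolding cube_group_def by blast
qed

text \<open>Reversing direction \<open>i\<close> moves \<open>p i\<close> into the diagonal factor
  and replaces it by its inverse.\<close>

lemma (in abelian_minimal_system) cube_group_flip:
  assumes "finite I" "h \<in> cube_group I" "i \<in> I"
  shows "(\<lambda>\<alpha>. h (flip i \<alpha>)) \<in> cube_group I"
proof -
  obtain g p where g: "g \<in> carrier G" "p \<in> I \<rightarrow> carrier G" "\<And>\<alpha>. \<alpha> \<subseteq> I \<Longrightarrow> h \<alpha> = g \<otimes> finprod G p \<alpha>"
    using assms(2) by (auto simp: cube_group_def)
  have pi: "p i \<in> carrier G" using g(2) assms(3) by auto
  have "h (flip i \<alpha>) = (g \<otimes> p i) \<otimes> finprod G (p(i := inv (p i))) \<alpha>" if "\<alpha> \<subseteq> I" for \<alpha>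
  proof -
    have fin: "finite \<alpha>" "p \<in> \<alpha> \<rightarrow> carrier G" using assms(1) g(2) that finite_subset by blast+
    have cl: "finprod G p \<beta> \<in> carrier G" if "\<beta> \<subseteq> \<alpha>" for \<beta> using fin(2) that by (intro finprod_closed) auto
    show ?thesis
    proof (cases "i \<in> \<alpha>")
      case True
      have "h (flip i \<alpha>) = g \<otimes> finprod G p (\<alpha> - {i})" using True that g(3)[of "\<alpha> - {i}"] by (auto simp: flip_def)
      also have "\<dots> = g \<otimes> (p i \<otimes> (inv (p i) \<otimes> finprod G p (\<alpha> - {i})))"
        using pi cl[of "\<alpha> - {i}"] by (simp add: m_assoc[symmetric])
      finally show ?thesis using True fin pi g(1) cl[of "\<alpha> - {i}"] by (simp add: finprod_update m_assoc)
    next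
      case False
      have "h (flip i \<alpha>) = g \<otimes> finprod G p (insert i \<alpha>)"
        using False that assms(3) g(3)[of "insert i \<alpha>"] by (auto simp: flip_def)
      then show ?thesis using False fin pi g(1) cl[of \<alpha>] by (simp add: finprod_update m_assoc)
    qed
  qed
  moreover have "p(i := inv (p i)) \<in> I \<rightarrow> carrier G" using g(2) pi by auto
  ultimately show ?thesis using g(1) pi m_closed unfolding cube_group_def by blast
qed

lemma (in abelian_minimal_system) near_diagonal_cong:
  assumes "\<And>\<alpha>. \<alpha> \<subseteq> I \<Longrightarrow> z \<alpha> = w \<alpha>"
  shows "near_diagonal I z \<longleftrightarrow> near_diagonal I w"
  using assms unfolding near_diagonal_def by simp

lemma (in abelian_minimal_system) near_diagonal_remove:
  assumes "finite I" "near_diagonal I z"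
  shows "near_diagonal I (\<lambda>\<alpha>. z (\<alpha> - {j}))"
  unfolding near_diagonal_def
proof (intro allI impI)
  fix e :: real assume "e > 0"
  then obtain h where h: "h \<in> cube_group I" "\<And>\<alpha> \<beta>. \<alpha> \<subseteq> I \<Longrightarrow> \<beta> \<subseteq> I \<Longrightarrow> dist (\<phi> (h \<alpha>) (z \<alpha>)) (\<phi> (h \<beta>) (z \<beta>)) < e"
    using assms(2) unfolding near_diagonal_def by meson
  have "dist (\<phi> (h (\<alpha> - {j})) (z (\<alpha> - {j}))) (\<phi> (h (\<beta> - {j})) (z (\<beta> - {j}))) < e"
    if "\<alpha> \<subseteq> I" "\<beta> \<subseteq> I" for \<alpha> \<beta> using that by (intro h(2)) auto
  then show "\<exists>h\<in>cube_group I. \<forall>\<alpha> \<beta>. \<alpha> \<subseteq> I \<longrightarrow> \<beta> \<subseteq> I \<longrightarrow>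
       dist (\<phi> (h \<alpha>) (z (\<alpha> - {j}))) (\<phi> (h \<beta>) (z (\<beta> - {j}))) < e"
    using cube_group_remove[OF assms(1) h(1), of j] by (intro bexI) auto
qed

lemma (in abelian_minimal_system) near_diagonal_flip:
  assumes "finite I" "near_diagonal I z" "i \<in> I"
  shows "near_diagonal I (\<lambda>\<alpha>. z (flip i \<alpha>))"
  unfolding near_diagonal_def
proof (intro allI impI)
  fix e :: real assume "e > 0"
  then obtain h where h: "h \<in> cube_group I" "\<And>\<alpha> \<beta>. \<alpha> \<subseteq> I \<Longrightarrow> \<beta> \<subseteq> I \<Longrightarrow> dist (\<phi> (h \<alpha>) (z \<alpha>)) (\<phi> (h \<beta>) (z \<beta>)) < e"
    using assms(2) unfolding near_diagonal_def by meson
  have "flip i \<alpha> \<subseteq> I" if "\<alpha> \<subseteq> I" for \<alpha> using that assms(3) by (auto simp: flip_def)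
  then show "\<exists>h\<in>cube_group I. \<forall>\<alpha> \<beta>. \<alpha> \<subseteq> I \<longrightarrow> \<beta> \<subseteq> I \<longrightarrow>
       dist (\<phi> (h \<alpha>) (z (flip i \<alpha>))) (\<phi> (h \<beta>) (z (flip i \<beta>))) < e"
    using cube_group_flip[OF assms(1) h(1) assms(3)] h(2) by (intro bexI) auto
qed

lemma (in abelian_minimal_system) near_diagonal_const:
  assumes "c \<in> X"
  shows "near_diagonal I (\<lambda>_. c)"
  unfolding near_diagonal_def using assms cube_group_translate[OF one_closed, of I]
  by (intro allI impI bexI[of _ "\<lambda>_. \<one>"]) simp_all

lemma (in abelian_minimal_system) near_diagonal_reach:
  assumes I: "finite I" and z: "z \<in> Pow I \<rightarrow> X" and w: "w \<in> Pow I \<rightarrow> X"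
    and zw: "reach (cube_group I) (Pow I) z w" and "near_diagonal I w"
  shows "near_diagonal I z"
  unfolding near_diagonal_def
proof (intro allI impI)
  fix e :: real assume e: "e > 0"
  then obtain h where h: "h \<in> cube_group I"
    "\<And>\<alpha> \<beta>. \<alpha> \<subseteq> I \<Longrightarrow> \<beta> \<subseteq> I \<Longrightarrow> dist (\<phi> (h \<alpha>) (w \<alpha>)) (\<phi> (h \<beta>) (w \<beta>)) < e/3"
    using assms(5) unfolding near_diagonal_def by (metis zero_less_divide_iff zero_less_numeral)
  have hc: "h ` Pow I \<subseteq> carrier G" using cube_group_closed[OF h(1)] by blast
  obtain d where d: "d > 0" "\<forall>g\<in>h ` Pow I. \<forall>x\<in>X. \<forall>y\<in>X. dist x y < d \<longrightarrow> dist (\<phi> g x) (\<phi> g y) < e/3"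
    using act_uniform[OF _ hc, of "e/3"] I e by auto
  obtain k where k: "k \<in> cube_group I" "\<And>\<alpha>. \<alpha> \<subseteq> I \<Longrightarrow> dist (\<phi> (k \<alpha>) (z \<alpha>)) (w \<alpha>) < d"
    using zw d(1) unfolding reach_def by (meson PowI)
  have hk: "dist (\<phi> (h \<alpha> \<otimes> k \<alpha>) (z \<alpha>)) (\<phi> (h \<alpha>) (w \<alpha>)) < e/3" if "\<alpha> \<subseteq> I" for \<alpha>
  proof -
    have "z \<alpha> \<in> X" "w \<alpha> \<in> X" "h \<alpha> \<in> carrier G" "k \<alpha> \<in> carrier G"
      using that z w cube_group_closed h(1) k(1) by auto
    then show ?thesis using d(2) k(2)[OF that] that by (simp add: act_mult)
  qed
  have "dist (\<phi> (h \<alpha> \<otimes> k \<alpha>) (z \<alpha>)) (\<phi> (h \<beta> \<otimes> k \<beta>) (z \<beta>)) < e" if "\<alpha> \<subseteq> I" "\<beta> \<subseteq> I" for \<alpha> \<beta>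
    using hk[OF that(1)] hk[OF that(2)] h(2)[OF that]
      dist_triangle[of "\<phi> (h \<alpha> \<otimes> k \<alpha>) (z \<alpha>)" "\<phi> (h \<beta> \<otimes> k \<beta>) (z \<beta>)" "\<phi> (h \<alpha>) (w \<alpha>)"]
      dist_triangle[of "\<phi> (h \<alpha>) (w \<alpha>)" "\<phi> (h \<beta> \<otimes> k \<beta>) (z \<beta>)" "\<phi> (h \<beta>) (w \<beta>)"]
    by (simp add: dist_commute)
  then show "\<exists>h\<in>cube_group I. \<forall>\<alpha> \<beta>. \<alpha> \<subseteq> I \<longrightarrow> \<beta> \<subseteq> I \<longrightarrow> dist (\<phi> (h \<alpha>) (z \<alpha>)) (\<phi> (h \<beta>) (z \<beta>)) < e"
    using cube_group_mult[OF h(1) k(1)] by (intro bexI) auto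
qed

lemma (in distal_system) cube_reach_sym:
  assumes "finite I" "z \<in> Pow I \<rightarrow> X" "w \<in> Pow I \<rightarrow> X" "reach (cube_group I) (Pow I) z w"
  shows "reach (cube_group I) (Pow I) w z"
  by (rule reach_sym[OF _ _ _ assms(2-4)]) (use assms(1) cube_group_closed cube_group_mult in auto)

text \<open>Distality reverses the orbit closure relation, after which a path from \<open>w\<close>
  to \<open>z\<close> can be followed by one from \<open>z\<close> to the diagonal.\<close>

lemma (in distal_system) near_diagonal_reached:
  assumes "finite I" "z \<in> Pow I \<rightarrow> X" "w \<in> Pow I \<rightarrow> X"
    "reach (cube_group I) (Pow I) z w" "near_diagonal I z"
  shows "near_diagonal I w"
  using near_diagonal_reach[OF assms(1,3,2) cube_reach_sym[OF assms(1-4)] assms(5)] .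

text \<open>Once all coordinates are close together, one diagonal translate from a finite, hence
  uniformly continuous, set brings them all near \<open>c\<close>.\<close>

lemma (in abelian_minimal_system) near_diagonal_reach_const:
  assumes I: "finite I" and z: "z \<in> Pow I \<rightarrow> X" and "near_diagonal I z" and c: "c \<in> X"
  shows "reach (cube_group I) (Pow I) z (\<lambda>_. c)"
  unfolding reach_def
proof (intro allI impI)
  fix e :: real assume e: "e > 0"
  have V: "openin (top_of_set X) (X \<inter> ball c (e/2))" "X \<inter> ball c (e/2) \<noteq> {}"
    using e c by (auto simp: openin_open_Int)
  obtain T where T: "finite T" "T \<subseteq> carrier G" "\<And>z. z \<in> X \<Longrightarrow> \<exists>t\<in>T. \<phi> t z \<in> X \<inter> ball c (e/2)"
    by (rule finitely_many_translates[OF V]) blast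
  obtain \<delta> where \<delta>: "\<delta> > 0" "\<forall>g\<in>T. \<forall>x\<in>X. \<forall>y\<in>X. dist x y < \<delta> \<longrightarrow> dist (\<phi> g x) (\<phi> g y) < e/2"
    using act_uniform[OF T(1,2), of "e/2"] e by auto
  obtain h where h: "h \<in> cube_group I"
    "\<And>\<alpha> \<beta>. \<alpha> \<subseteq> I \<Longrightarrow> \<beta> \<subseteq> I \<Longrightarrow> dist (\<phi> (h \<alpha>) (z \<alpha>)) (\<phi> (h \<beta>) (z \<beta>)) < \<delta>"
    using assms(3) \<delta>(1) unfolding near_diagonal_def by meson
  have hX: "h \<alpha> \<in> carrier G" "z \<alpha> \<in> X" if "\<alpha> \<subseteq> I" for \<alpha>
    using that z cube_group_closed[OF h(1)] by auto
  obtain t where t: "t \<in> T" "\<phi> t (\<phi> (h {}) (z {})) \<in> X \<inter> ball c (e/2)"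
    using T(3) hX[of "{}"] by (meson act_closed empty_subsetI)
  have tc: "t \<in> carrier G" using t T by blast
  have "dist (\<phi> (t \<otimes> h \<alpha>) (z \<alpha>)) c < e" if "\<alpha> \<subseteq> I" for \<alpha>
  proof -
    have "dist (\<phi> t (\<phi> (h \<alpha>) (z \<alpha>))) (\<phi> t (\<phi> (h {}) (z {}))) < e/2"
      using \<delta>(2) t(1) h(2)[OF that, of "{}"] hX[OF that] hX[of "{}"] by simp
    moreover have "dist (\<phi> t (\<phi> (h {}) (z {}))) c < e/2" using t(2) by (simp add: dist_commute)
    ultimately show ?thesis
      using dist_triangle[of "\<phi> t (\<phi> (h \<alpha>) (z \<alpha>))" c "\<phi> t (\<phi> (h {}) (z {}))"] hX[OF that] tc by (simp add: act_mult)
  qed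
  then show "\<exists>h\<in>cube_group I. \<forall>\<alpha>\<in>Pow I. dist (\<phi> (h \<alpha>) (z \<alpha>)) c < e"
    using cube_group_mult[OF cube_group_translate[OF tc] h(1)] by (intro bexI) auto
qed

lemma (in distal_system) const_reach_near_diagonal:
  assumes "finite I" "z \<in> Pow I \<rightarrow> X" "near_diagonal I z" "c \<in> X"
  shows "reach (cube_group I) (Pow I) (\<lambda>_. c) z"
  by (rule cube_reach_sym[OF assms(1,2) _ near_diagonal_reach_const[OF assms]]) (use assms(4) in simp)

text \<open>The elements that bring the approximants near the diagonal have no common modulus of
  continuity. Instead one constant reaches every approximant, hence also their limit.\<close>

lemma (in distal_system) near_diagonal_limit:
  assumes I: "finite I" and z: "z \<in> Pow I \<rightarrow> X"
    and lim: "\<And>e. e > 0 \<Longrightarrow> \<exists>w. w \<in> Pow I \<rightarrow> X \<and> near_diagonal I w \<and> (\<forall>\<alpha>\<in>Pow I. dist (w \<alpha>) (z \<alpha>) < e)"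
  shows "near_diagonal I z"
proof -
  obtain c where c: "c \<in> X" using nonempty_space by blast
  have "reach (cube_group I) (Pow I) (\<lambda>_. c) z"
    unfolding reach_def
  proof (intro allI impI)
    fix e :: real assume e: "e > 0"
    then obtain w where w: "w \<in> Pow I \<rightarrow> X" "near_diagonal I w" "\<forall>\<alpha>\<in>Pow I. dist (w \<alpha>) (z \<alpha>) < e/2"
      using lim[of "e/2"] by auto
    obtain h where h: "h \<in> cube_group I" "\<forall>\<alpha>\<in>Pow I. dist (\<phi> (h \<alpha>) c) (w \<alpha>) < e/2"
      using const_reach_near_diagonal[OF I w(1,2) c] e unfolding reach_def by (meson half_gt_zero)
    have "dist (\<phi> (h \<alpha>) c) (z \<alpha>) < e" if "\<alpha> \<in> Pow I" for \<alpha>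
      using h(2)[rule_format, OF that] w(3)[rule_format, OF that] dist_triangle[of "\<phi> (h \<alpha>) c" "z \<alpha>" "w \<alpha>"] by simp
    then show "\<exists>h\<in>cube_group I. \<forall>\<alpha>\<in>Pow I. dist (\<phi> (h \<alpha>) c) (z \<alpha>) < e" using h(1) by blast
  qed
  then show ?thesis
    using near_diagonal_reached[OF I _ z _ near_diagonal_const[OF c]] c by auto
qed

text \<open>
  Moving \<open>w\<close> towards the diagonal by \<open>h\<^sub>n\<close> makes its two faces agree; applying to \<open>z\<close> the part of
  \<open>h\<^sub>n\<close> that ignores \<open>i\<close>, both \<open>z\<close> and the glued cube converge to the same limit.
\<close>

lemma (in distal_system) near_diagonal_glue:
  assumes I: "finite I" and i: "i \<in> I" and z: "z \<in> Pow I \<rightarrow> X" and w: "w \<in> Pow I \<rightarrow> X"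
    and zw: "\<And>\<alpha>. \<alpha> \<subseteq> I \<Longrightarrow> i \<notin> \<alpha> \<Longrightarrow> z (insert i \<alpha>) = w \<alpha>"
    and Nz: "near_diagonal I z" and Nw: "near_diagonal I w"
  shows "near_diagonal I (\<lambda>\<alpha>. if i \<in> \<alpha> then w \<alpha> else z \<alpha>)"
proof -
  define v where "v = (\<lambda>\<alpha>. if i \<in> \<alpha> then w \<alpha> else z \<alpha>)"
  have v: "v \<in> Pow I \<rightarrow> X" using z w by (auto simp: v_def)
  have "\<exists>h\<in>cube_group I. \<forall>\<alpha> \<beta>. \<alpha> \<subseteq> I \<longrightarrow> \<beta> \<subseteq> I \<longrightarrow>
      dist (\<phi> (h \<alpha>) (w \<alpha>)) (\<phi> (h \<beta>) (w \<beta>)) < inverse (real (Suc n))" for n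
    using Nw unfolding near_diagonal_def by (metis inverse_positive_iff_positive of_nat_0_less_iff zero_less_Suc)
  then obtain h where h: "\<And>n. h n \<in> cube_group I"
    "\<And>n \<alpha> \<beta>. \<alpha> \<subseteq> I \<Longrightarrow> \<beta> \<subseteq> I \<Longrightarrow> dist (\<phi> (h n \<alpha>) (w \<alpha>)) (\<phi> (h n \<beta>) (w \<beta>)) < inverse (real (Suc n))"
    by metis
  define u where "u n \<alpha> = \<phi> (h n (\<alpha> - {i})) (z \<alpha>)" for n \<alpha>
  have uX: "u n \<alpha> \<in> X" if "\<alpha> \<in> Pow I" for n \<alpha>
  proof -
    have "z \<alpha> \<in> X" "h n (\<alpha> - {i}) \<in> carrier G"
      using that z cube_group_closed[OF h(1)[of n], of "\<alpha> - {i}"] by auto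
    then show ?thesis by (simp add: u_def)
  qed
  obtain r l where r: "strict_mono (r :: nat \<Rightarrow> nat)" "\<forall>\<alpha>\<in>Pow I. l \<alpha> \<in> X \<and> (\<lambda>n. u (r n) \<alpha>) \<longlonglongrightarrow> l \<alpha>"
    using finite_family_convergent_subsequence[OF _ compact_space, of "Pow I" u] I uX by blast
  have l: "l \<in> Pow I \<rightarrow> X" using r(2) by blast
  have close: "\<exists>n. (\<forall>\<alpha>\<in>Pow I. dist (u n \<alpha>) (l \<alpha>) < e) \<and> inverse (real (Suc n)) < e" if e: "e > 0" for e
  proof -
    have "eventually (\<lambda>n. \<forall>\<alpha>\<in>Pow I. dist (u (r n) \<alpha>) (l \<alpha>) < e) sequentially"
      using I r(2) e by (intro eventually_ball_finite) (auto intro: tendstoD)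
    moreover have "eventually (\<lambda>n. inverse (real (Suc (r n))) < e) sequentially"
      using LIMSEQ_subseq_LIMSEQ[OF LIMSEQ_inverse_real_of_nat r(1)] e
      unfolding o_def by (rule order_tendstoD(2))
    ultimately have "eventually (\<lambda>n. (\<forall>\<alpha>\<in>Pow I. dist (u (r n) \<alpha>) (l \<alpha>) < e) \<and> inverse (real (Suc (r n))) < e) sequentially"
      by (rule eventually_conj)
    then show ?thesis using eventually_happens' sequentially_bot by blast
  qed
  have "reach (cube_group I) (Pow I) z l"
    unfolding reach_def
  proof (intro allI impI)
    fix e :: real assume "e > 0"
    then obtain n where "\<forall>\<alpha>\<in>Pow I. dist (u n \<alpha>) (l \<alpha>) < e" using close by blast
    then show "\<exists>h\<in>cube_group I. \<forall>\<alpha>\<in>Pow I. dist (\<phi> (h \<alpha>) (z \<alpha>)) (l \<alpha>) < e"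
      using cube_group_remove[OF I h(1)[of n], of i] unfolding u_def by (rule bexI)
  qed
  then have Nl: "near_diagonal I l" by (rule near_diagonal_reached[OF I z l _ Nz])
  have "reach (cube_group I) (Pow I) v l"
    unfolding reach_def
  proof (intro allI impI)
    fix e :: real assume "e > 0"
    then obtain n where n: "\<forall>\<alpha>\<in>Pow I. dist (u n \<alpha>) (l \<alpha>) < e/2" "inverse (real (Suc n)) < e/2"
      using close[of "e/2"] by auto
    have "dist (\<phi> (h n \<alpha>) (v \<alpha>)) (l \<alpha>) < e" if \<alpha>: "\<alpha> \<in> Pow I" for \<alpha>
    proof (cases "i \<in> \<alpha>")
      case True
      \<comment> \<open>On the upper face \<open>z\<close> equals \<open>w\<close> at the opposite
        vertex, so the two points compared are two coordinates of \<open>w\<close> moved by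
        \<open>h n\<close>, which are close by its choice.\<close>
      then have "z \<alpha> = w (\<alpha> - {i})" using zw[of "\<alpha> - {i}"] \<alpha> by (auto simp: insert_absorb)
      then have "dist (\<phi> (h n \<alpha>) (v \<alpha>)) (u n \<alpha>) = dist (\<phi> (h n \<alpha>) (w \<alpha>)) (\<phi> (h n (\<alpha> - {i})) (w (\<alpha> - {i})))"
        using True by (simp add: v_def u_def)
      also have "\<dots> < inverse (real (Suc n))" using \<alpha> by (intro h(2)) auto
      finally have "dist (\<phi> (h n \<alpha>) (v \<alpha>)) (u n \<alpha>) < e/2" using n(2) by linarith
      then show ?thesis
        using n(1)[rule_format, OF \<alpha>] dist_triangle[of "\<phi> (h n \<alpha>) (v \<alpha>)" "l \<alpha>" "u n \<alpha>"] by linarith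
    next
      case False
      then have "\<phi> (h n \<alpha>) (v \<alpha>) = u n \<alpha>" by (simp add: v_def u_def)
      then show ?thesis using n(1)[rule_format, OF \<alpha>] \<open>e > 0\<close> by simp
    qed
    then show "\<exists>h\<in>cube_group I. \<forall>\<alpha>\<in>Pow I. dist (\<phi> (h \<alpha>) (v \<alpha>)) (l \<alpha>) < e" using h(1) by blast
  qed
  then have "near_diagonal I v" by (rule near_diagonal_reach[OF I v l _ Nl])
  then show ?thesis by (simp add: v_def)
qed

section \<open>Regionally proximal pairs in distal systems\<close>

text \<open>
  The cube with \<open>x\<close>, \<open>y\<close> at \<open>{}\<close>, \<open>{0}\<close> and arbitrary entries elsewhere, the same on both sides
  of the face \<open>0\<close>, is the definition of \<open>RP\<close> in the limit. Gluing in the directions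
  \<open>1, \<dots>, k\<close> one after the other replaces all the unknown entries by \<open>x\<close>.
\<close>

lemma (in distal_system) RP_near_diagonal:
  assumes xy: "(x, y) \<in> RP G X \<phi> k"
  shows "near_diagonal {0..k} (\<lambda>\<alpha>. if \<alpha> = {} then y else x)"
proof -
  have xyX: "x \<in> X" "y \<in> X" using xy by (auto simp: RP_def)
  have sub: "\<alpha> - {0} \<subseteq> {1..k}" if "\<alpha> \<subseteq> {0..k}" for \<alpha> using that by auto
  have "\<exists>x' y' p. x' \<in> X \<and> y' \<in> X \<and> p \<in> {1..k} \<rightarrow> carrier G \<and> dist x x' < inverse (real (Suc n)) \<and>
    dist y y' < inverse (real (Suc n)) \<and> (\<forall>g\<in>FP G k p. dist (\<phi> g x') (\<phi> g y') < inverse (real (Suc n)))" for n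
  proof -
    have "inverse (real (Suc n)) > 0" by simp
    then show ?thesis using xy unfolding RP_def by blast
  qed
  then obtain x' y' p where xy': "\<And>n. x' n \<in> X" "\<And>n. y' n \<in> X" "\<And>n. p n \<in> {1..k} \<rightarrow> carrier G"
    "\<And>n. dist x (x' n) < inverse (real (Suc n))" "\<And>n. dist y (y' n) < inverse (real (Suc n))"
    "\<And>n g. g \<in> FP G k (p n) \<Longrightarrow> dist (\<phi> g (x' n)) (\<phi> g (y' n)) < inverse (real (Suc n))"
    by metis
  have pc: "finprod G (p n) \<alpha> \<in> carrier G" if "\<alpha> \<subseteq> {1..k}" for n \<alpha>
    using xy'(3)[of n] that by (intro finprod_closed) auto
  \<comment> \<open>Direction 0 passes from \<open>x' n\<close> to \<open>y' n\<close>; directions 1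
    to \<open>k\<close> are the generators \<open>p n\<close>.\<close>
  define u where "u n \<alpha> = \<phi> (finprod G (p n) (\<alpha> - {0})) (if 0 \<in> \<alpha> then y' n else x' n)" for n and \<alpha> :: "nat set"
  have uX: "u n \<alpha> \<in> X" if "\<alpha> \<in> Pow {0..k}" for n \<alpha>
    using pc[OF sub] that xy'(1,2) by (simp add: u_def)
  have Nu: "near_diagonal {0..k} (u n)" for n
  proof (rule near_diagonal_reached[OF _ _ _ _ near_diagonal_const[OF xy'(1)[of n]]])
    show "reach (cube_group {0..k}) (Pow {0..k}) (\<lambda>_. x' n) (u n)"
      unfolding reach_def
    proof (intro allI impI)
      fix e :: real assume e: "e > 0"
      have "(\<lambda>\<alpha>. finprod G (p n) \<alpha>) ` Pow {1..k} \<subseteq> carrier G" using pc by blast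
      from act_uniform[OF _ this e] obtain d where d: "d > 0"
        "\<And>\<alpha> x y. \<alpha> \<subseteq> {1..k} \<Longrightarrow> x \<in> X \<Longrightarrow> y \<in> X \<Longrightarrow> dist x y < d \<Longrightarrow>
          dist (\<phi> (finprod G (p n) \<alpha>) x) (\<phi> (finprod G (p n) \<alpha>) y) < e" by auto
      have "openin (top_of_set X) (X \<inter> ball (y' n) d)" "X \<inter> ball (y' n) d \<noteq> {}"
        using d(1) xy'(2)[of n] by (auto simp: openin_open_Int)
      \<comment> \<open>The point \<open>y' n\<close> need not lie in the orbit of
        \<open>x' n\<close>. A translate approximates it well enough for all the finitely many
        products, and \<open>t\<close> becomes the generator in direction 0.\<close>
      from dense_orbit[OF xy'(1)[of n] this] obtain t where
        t: "t \<in> carrier G" "dist (\<phi> t (x' n)) (y' n) < d" by (auto simp: dist_commute)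
      define h where "h \<alpha> = \<one> \<otimes> finprod G ((p n)(0 := t)) \<alpha>" for \<alpha>
      have "(p n)(0 := t) \<in> {0..k} \<rightarrow> carrier G" using xy'(3)[of n] t(1) by (auto simp: Pi_iff)
      then have "h \<in> cube_group {0..k}" unfolding cube_group_def h_def by blast
      moreover have "dist (\<phi> (h \<alpha>) (x' n)) (u n \<alpha>) < e" if "\<alpha> \<in> Pow {0..k}" for \<alpha>
      proof -
        have \<alpha>: "\<alpha> \<subseteq> {0..k}" "finite \<alpha>" using that finite_subset by auto
        have "finprod G ((p n)(0 := t)) \<alpha> = (if 0 \<in> \<alpha> then t \<otimes> finprod G (p n) (\<alpha> - {0}) else finprod G (p n) (\<alpha> - {0}))"
        proof (cases "0 \<in> \<alpha>")
          case True
          have "finprod G ((p n)(0 := t)) \<alpha> = finprod G ((p n)(0 := t)) (insert 0 (\<alpha> - {0}))"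
            using True by (simp add: insert_absorb)
          also have "\<dots> = t \<otimes> finprod G ((p n)(0 := t)) (\<alpha> - {0})"
            by (subst finprod_insert) (use \<alpha> sub[OF \<alpha>(1)] xy'(3)[of n] t(1) in auto)
          also have "finprod G ((p n)(0 := t)) (\<alpha> - {0}) = finprod G (p n) (\<alpha> - {0})"
            by (rule finprod_cong') (use sub[OF \<alpha>(1)] xy'(3)[of n] in auto)
          finally show ?thesis using True by (simp only: if_True)
        next
          case False
          then have "\<alpha> - {0} = \<alpha>" by blast
          then show ?thesis using False sub[OF \<alpha>(1)] xy'(3)[of n]
            by (simp, intro finprod_cong') auto
        qed
        then have "\<phi> (h \<alpha>) (x' n) = \<phi> (finprod G (p n) (\<alpha> - {0})) (if 0 \<in> \<alpha> then \<phi> t (x' n) else x' n)"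
          using pc[OF sub[OF \<alpha>(1)], of n] t(1) xy'(1)[of n] act_commute[OF t(1)]
          by (cases "0 \<in> \<alpha>") (simp_all only: h_def if_True if_False l_one m_closed act_mult)
        then show ?thesis
          using d(2)[OF sub[OF \<alpha>(1)], of "\<phi> t (x' n)" "y' n"] t xy'(1,2)[of n] e by (simp add: u_def)
      qed
      ultimately show "\<exists>h\<in>cube_group {0..k}. \<forall>\<alpha>\<in>Pow {0..k}. dist (\<phi> (h \<alpha>) (x' n)) (u n \<alpha>) < e" by blast
    qed
  qed (use uX xy'(1) in auto)
  obtain r z where r: "strict_mono (r :: nat \<Rightarrow> nat)" "\<forall>\<alpha>\<in>Pow {0..k}. z \<alpha> \<in> X \<and> (\<lambda>n. u (r n) \<alpha>) \<longlonglongrightarrow> z \<alpha>"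
    using finite_family_convergent_subsequence[OF _ compact_space, of "Pow {0..k}" u] uX by blast
  have inv: "(\<lambda>n. inverse (real (Suc (r n)))) \<longlonglongrightarrow> 0"
    using LIMSEQ_subseq_LIMSEQ[OF LIMSEQ_inverse_real_of_nat r(1)] by (simp add: o_def)
  have zX: "z \<in> Pow {0..k} \<rightarrow> X" using r(2) by blast
  have Nz: "near_diagonal {0..k} z"
  proof (rule near_diagonal_limit[OF _ zX])
    fix e :: real assume e: "e > 0"
    have "eventually (\<lambda>n. \<forall>\<alpha>\<in>Pow {0..k}. dist (u (r n) \<alpha>) (z \<alpha>) < e) sequentially"
      using r(2) e by (intro eventually_ball_finite) (auto intro: tendstoD)
    then obtain n where "\<forall>\<alpha>\<in>Pow {0..k}. dist (u (r n) \<alpha>) (z \<alpha>) < e"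
      using eventually_happens' sequentially_bot by blast
    then show "\<exists>w. w \<in> Pow {0..k} \<rightarrow> X \<and> near_diagonal {0..k} w \<and> (\<forall>\<alpha>\<in>Pow {0..k}. dist (w \<alpha>) (z \<alpha>) < e)"
      using Nu uX by (intro exI[of _ "u (r n)"]) auto
  qed simp
  have z0: "z {} = x"
  proof (rule LIMSEQ_unique)
    show "(\<lambda>n. u (r n) {}) \<longlonglongrightarrow> z {}" using r(2) by simp
    have "(\<lambda>n. dist (u (r n) {}) x) \<longlonglongrightarrow> 0"
    proof (rule tendsto_sandwich[OF _ _ tendsto_const inv])
      show "eventually (\<lambda>n. dist (u (r n) {}) x \<le> inverse (real (Suc (r n)))) sequentially"
      proof (intro always_eventually allI)
        fix n
        have *: "u (r n) {} = x' (r n)" using xy'(1) by (simp add: u_def)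
        show "dist (u (r n) {}) x \<le> inverse (real (Suc (r n)))"
          unfolding * dist_commute[of "x' (r n)"] using xy'(4) by (rule less_imp_le)
      qed
    qed simp
    then show "(\<lambda>n. u (r n) {}) \<longlonglongrightarrow> x" by (rule tendsto_dist_iff[THEN iffD2])
  qed
  have z1: "z {0} = y"
  proof (rule LIMSEQ_unique)
    show "(\<lambda>n. u (r n) {0}) \<longlonglongrightarrow> z {0}" using r(2) by simp
    have "(\<lambda>n. dist (u (r n) {0}) y) \<longlonglongrightarrow> 0"
    proof (rule tendsto_sandwich[OF _ _ tendsto_const inv])
      show "eventually (\<lambda>n. dist (u (r n) {0}) y \<le> inverse (real (Suc (r n)))) sequentially"
      proof (intro always_eventually allI)
        fix n
        have *: "u (r n) {0} = y' (r n)" using xy'(2) by (simp add: u_def)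
        show "dist (u (r n) {0}) y \<le> inverse (real (Suc (r n)))"
          unfolding * dist_commute[of "y' (r n)"] using xy'(5) by (rule less_imp_le)
      qed
    qed simp
    then show "(\<lambda>n. u (r n) {0}) \<longlonglongrightarrow> y" by (rule tendsto_dist_iff[THEN iffD2])
  qed
  have z2: "z (insert 0 \<alpha>) = z \<alpha>" if \<alpha>: "\<alpha> \<subseteq> {1..k}" "\<alpha> \<noteq> {}" for \<alpha>
  proof -
    have \<alpha>0: "\<alpha> - {0} = \<alpha>" "0 \<notin> \<alpha>" using \<alpha>(1) by auto
    have "finprod G (p n) \<alpha> \<in> FP G k (p n)" for n
      using FP_eq_finprod[OF xy'(3)] \<alpha> by blast
    then have d: "dist (u (r n) \<alpha>) (u (r n) (insert 0 \<alpha>)) < inverse (real (Suc (r n)))" for n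
      using xy'(6) \<alpha>0 by (simp add: u_def)
    have "\<alpha> \<in> Pow {0..k}" "insert 0 \<alpha> \<in> Pow {0..k}" using \<alpha>(1) by auto
    then have "(\<lambda>n. dist (u (r n) \<alpha>) (u (r n) (insert 0 \<alpha>))) \<longlonglongrightarrow> dist (z \<alpha>) (z (insert 0 \<alpha>))"
      using r(2) by (intro tendsto_dist) auto
    then have "dist (z \<alpha>) (z (insert 0 \<alpha>)) \<le> 0"
      using LIMSEQ_le[OF _ inv] d less_imp_le by meson
    then show ?thesis by simp
  qed
  \<comment> \<open>The state after treating directions 1 to \<open>j\<close>: a vertex meeting
    \<open>{1..j}\<close> takes its entry from the vertex without the coordinates 0 to
    \<open>j\<close>. For \<open>j = k\<close> that entry is \<open>z {}\<close>, so on
    \<open>Pow {0..k}\<close> only \<open>{0}\<close> keeps \<open>y\<close>.\<close>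
  define Z where "Z j \<alpha> = (if \<alpha> \<inter> {1..j} = {} then z \<alpha> else z (\<alpha> - {0..j}))" for j and \<alpha> :: "nat set"
  have ZX: "Z j \<in> Pow {0..k} \<rightarrow> X" for j
    using zX by (auto simp: Z_def Pi_iff)
  have "j \<le> k \<Longrightarrow> near_diagonal {0..k} (Z j)" for j
  proof (induction j)
    case 0
    have "Z 0 = z" by (auto simp: Z_def fun_eq_iff)
    then show ?case using Nz by simp
  next
    case (Suc j)
    then have N: "near_diagonal {0..k} (Z j)" and i: "Suc j \<in> {0..k}" by simp_all
    \<comment> \<open>The cube \<open>Z j\<close>, made degenerate in direction 0 and reversed in
      direction \<open>Suc j\<close>. Its lower face matches the upper face of \<open>Z j\<close>,
      where coordinate 0 has no influence by \<open>z2\<close> or by the construction of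
      \<open>Z j\<close>.\<close>
    define w where "w \<alpha> = Z j (flip (Suc j) \<alpha> - {0})" for \<alpha>
    have Nw: "near_diagonal {0..k} w"
      using near_diagonal_flip[OF _ near_diagonal_remove[OF _ N, of 0] i] unfolding w_def by simp
    have wX: "w \<in> Pow {0..k} \<rightarrow> X"
    proof
      fix \<alpha> assume "\<alpha> \<in> Pow {0..k}"
      then have "flip (Suc j) \<alpha> - {0} \<in> Pow {0..k}" using i by (auto simp: flip_def)
      then show "w \<alpha> \<in> X" using ZX[of j] unfolding w_def by blast
    qed
    have "Z j (insert (Suc j) \<alpha>) = w \<alpha>" if \<alpha>: "\<alpha> \<subseteq> {0..k}" "Suc j \<notin> \<alpha>" for \<alpha>
    proof (cases "insert (Suc j) \<alpha> \<inter> {1..j} = {}")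
      case True
      define \<beta> where "\<beta> = insert (Suc j) \<alpha> - {0}"
      have \<beta>: "\<beta> \<subseteq> {1..k}" "\<beta> \<noteq> {}" using \<alpha> i by (auto simp: \<beta>_def)
      have "\<beta> \<inter> {1..j} = {}" using True by (auto simp: \<beta>_def)
      moreover have "w \<alpha> = Z j \<beta>" using \<alpha> by (simp add: w_def flip_def \<beta>_def)
      ultimately have "w \<alpha> = z \<beta>" by (simp add: Z_def)
      moreover have "insert (Suc j) \<alpha> = (if 0 \<in> \<alpha> then insert 0 \<beta> else \<beta>)" by (auto simp: \<beta>_def)
      ultimately show ?thesis using True z2[OF \<beta>] by (simp add: Z_def)
    next
      case False
      define \<beta> where "\<beta> = insert (Suc j) \<alpha> - {0}"
      have "\<beta> \<inter> {1..j} = insert (Suc j) \<alpha> \<inter> {1..j}" "\<beta> - {0..j} = insert (Suc j) \<alpha> - {0..j}"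
        by (auto simp: \<beta>_def)
      then have "\<beta> \<inter> {1..j} \<noteq> {}" "\<beta> - {0..j} = insert (Suc j) \<alpha> - {0..j}" using False by simp_all
      moreover have "w \<alpha> = Z j \<beta>" using \<alpha> by (simp add: w_def flip_def \<beta>_def)
      ultimately show ?thesis using False by (simp add: Z_def)
    qed
    then have "near_diagonal {0..k} (\<lambda>\<alpha>. if Suc j \<in> \<alpha> then w \<alpha> else Z j \<alpha>)"
      by (intro near_diagonal_glue[OF _ i ZX wX _ N Nw]) simp_all
    moreover have "(if Suc j \<in> \<alpha> then w \<alpha> else Z j \<alpha>) = Z (Suc j) \<alpha>" for \<alpha>
    proof (cases "Suc j \<in> \<alpha>")
      case True
      define \<beta> where "\<beta> = \<alpha> - {Suc j} - {0}"
      have w: "w \<alpha> = Z j \<beta>" using True by (simp add: w_def flip_def \<beta>_def)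
      have eq: "\<beta> - {0..j} = \<alpha> - {0..Suc j}" by (auto simp: \<beta>_def le_Suc_eq)
      have "Z j \<beta> = z (\<alpha> - {0..Suc j})"
      proof (cases "\<beta> \<inter> {1..j} = {}")
        case True
        then have "\<beta> = \<beta> - {0..j}" unfolding \<beta>_def by (auto simp: Suc_le_eq)
        then show ?thesis using eq True by (simp add: Z_def)
      next
        case False
        then show ?thesis using eq by (simp add: Z_def)
      qed
      moreover have "\<alpha> \<inter> {1..Suc j} \<noteq> {}" using True by auto
      ultimately show ?thesis using True w by (simp add: Z_def)
    next
      case False
      then have "\<alpha> \<inter> {1..Suc j} = \<alpha> \<inter> {1..j}" "\<alpha> - {0..Suc j} = \<alpha> - {0..j}"
        by (auto simp: le_Suc_eq)
      then show ?thesis using False by (simp add: Z_def)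
    qed
    ultimately show ?case by simp
  qed
  then have "near_diagonal {0..k} (Z k)" by simp
  \<comment> \<open>The reversal moves the exceptional entry \<open>y\<close> from
    \<open>{0}\<close> to the base vertex.\<close>
  then have "near_diagonal {0..k} (\<lambda>\<alpha>. Z k (flip 0 \<alpha>))"
    by (intro near_diagonal_flip) auto
  moreover have "Z k (flip 0 \<alpha>) = (if \<alpha> = {} then y else x)" if \<alpha>: "\<alpha> \<subseteq> {0..k}" for \<alpha>
  proof -
    define \<beta> where "\<beta> = flip 0 \<alpha>"
    have \<beta>: "\<beta> \<subseteq> {0..k}" using \<alpha> by (auto simp: \<beta>_def flip_def)
    have \<alpha>\<beta>: "\<alpha> = {} \<longleftrightarrow> \<beta> = {0}" by (auto simp: \<beta>_def flip_def)
    show ?thesis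
    proof (cases "\<beta> \<inter> {1..k} = {}")
      case True
      have "b = 0" if "b \<in> \<beta>" for b
      proof (rule ccontr)
        assume "b \<noteq> 0"
        then have "b \<in> \<beta> \<inter> {1..k}" using that \<beta> by auto
        then show False using True by blast
      qed
      then have "\<beta> = {} \<or> \<beta> = {0}" by blast
      then show ?thesis using True z0 z1 \<alpha>\<beta> unfolding \<beta>_def[symmetric] by (auto simp: Z_def)
    next
      case False
      then have "Z k \<beta> = z {}" using \<beta> by (auto simp: Z_def Diff_eq_empty_iff[THEN iffD2])
      then show ?thesis using False z0 \<alpha>\<beta> unfolding \<beta>_def[symmetric] by auto
    qed
  qed
  ultimately show ?thesis
    using near_diagonal_cong[of "{0..k}" "\<lambda>\<alpha>. Z k (flip 0 \<alpha>)"] by simp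
qed

lemma RP_sym: "(x, y) \<in> RP G X \<phi> k \<Longrightarrow> (y, x) \<in> RP G X \<phi> k"
  unfolding RP_def by clarsimp (metis dist_commute)

text \<open>The gain over \<open>RP\<close> is that one point near \<open>x\<close> is moved near
  the fixed \<open>y\<close>, instead of two points being moved near each other. All vertices are
  images of the same \<open>x\<close>, so the diagonal factor \<open>g\<close> yields
  \<open>x'\<close> and the remaining factors are the products.\<close>

lemma (in distal_system) RP_cube:
  assumes xy: "(x, y) \<in> RP G X \<phi> k" and e: "e > 0"
  shows "\<exists>x'\<in>X. \<exists>p. p \<in> {1..k} \<rightarrow> carrier G \<and> dist x x' < e \<and> (\<forall>g\<in>FP G k p. dist y (\<phi> g x') < e)"
proof -
  have xyX: "x \<in> X" "y \<in> X" using xy by (auto simp: RP_def)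
  \<comment> \<open>Symmetry of \<open>RP\<close> puts \<open>x\<close>, rather than
    \<open>y\<close>, at the exceptional vertex.\<close>
  have "reach (cube_group {0..k}) (Pow {0..k}) (\<lambda>_. x) (\<lambda>\<alpha>. if \<alpha> = {} then x else y)"
    by (rule const_reach_near_diagonal[OF _ _ RP_near_diagonal[OF RP_sym[OF xy]] xyX(1)]) (use xyX in auto)
  then obtain h where h: "h \<in> cube_group {0..k}"
    "\<And>\<alpha>. \<alpha> \<subseteq> {0..k} \<Longrightarrow> dist (\<phi> (h \<alpha>) x) (if \<alpha> = {} then x else y) < e"
    using e unfolding reach_def by (meson PowI)
  obtain g p where g: "g \<in> carrier G" "p \<in> {0..k} \<rightarrow> carrier G" "\<And>\<alpha>. \<alpha> \<subseteq> {0..k} \<Longrightarrow> h \<alpha> = g \<otimes> finprod G p \<alpha>"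
    using h(1) by (auto simp: cube_group_def)
  have p: "p \<in> {1..k} \<rightarrow> carrier G" using g(2) by auto
  show ?thesis
  proof (intro bexI[of _ "\<phi> g x"] exI[of _ p] conjI ballI)
    show "dist x (\<phi> g x) < e" using h(2)[of "{}"] g(3)[of "{}"] g(1) by (simp add: dist_commute)
    fix q assume "q \<in> FP G k p"
    then obtain \<alpha> where \<alpha>: "\<alpha> \<noteq> {}" "\<alpha> \<subseteq> {1..k}" "q = finprod G p \<alpha>"
      unfolding FP_eq_finprod[OF p] by blast
    have q: "q \<in> carrier G" unfolding \<alpha>(3) using p \<alpha>(2) by (intro finprod_closed) auto
    have "\<alpha> \<subseteq> {0..k}" using \<alpha>(2) by auto
    then have "dist (\<phi> (g \<otimes> q) x) y < e" using h(2)[of \<alpha>] g(3)[of \<alpha>] \<alpha> by simp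
    then show "dist y (\<phi> q (\<phi> g x)) < e"
      using act_mult[OF g(1) q xyX(1)] act_commute[OF g(1) q xyX(1)] by (simp add: dist_commute)
  qed (use p g(1) xyX in auto)
qed

text \<open>The point from \<open>RP_cube\<close> changes with \<open>k\<close>, so it is replaced
  by a small compact neighborhood. Inside such a set the construction is repeated around a translate
  of \<open>x\<close>; distality ensures that the same translate of \<open>y\<close> stays away from
  \<open>x\<close>.\<close>

lemma (in distal_system) equicontinuous_imp_RP_infinity_trivial:
  assumes eq: "pairwise_FIP_star_equicontinuous G X \<phi>" and xy: "(x, y) \<in> RP_infinity G X \<phi>"
  shows "x = y"
proof (rule ccontr)
  assume "x \<noteq> y"
  have RP: "(x, y) \<in> RP G X \<phi> (Suc k)" for k using xy by (auto simp: RP_infinity_def)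
  then have xyX: "x \<in> X" "y \<in> X" by (auto simp: RP_def)
  obtain e where e: "e > 0" "\<And>g. g \<in> carrier G \<Longrightarrow> e \<le> dist (\<phi> g x) (\<phi> g y)"
    using distal[OF xyX] \<open>x \<noteq> y\<close> by (meson not_less)
  \<comment> \<open>The translates \<open>t x\<close> and \<open>t y\<close> are at least
    \<open>4 * \<eta>\<close> apart. Passing from \<open>t x\<close> to \<open>x\<close> and from
    \<open>t y\<close> to the image of \<open>a\<close> costs less than \<eta> each, which leaves
    \<open>2 * \<eta>\<close>.\<close>
  define \<eta> where "\<eta> = e / 4"
  have \<eta>: "\<eta> > 0" using e(1) by (simp add: \<eta>_def)
  define \<A> where "\<A> = {A. compact A \<and> A \<subseteq> X \<inter> ball x \<eta> \<and> (\<exists>V. openin (top_of_set X) V \<and> V \<noteq> {} \<and> V \<subseteq> A)}"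
  have ballA: "X \<inter> cball a d \<in> \<A>" if "a \<in> X" "d > 0" "X \<inter> cball a d \<subseteq> ball x \<eta>" for a d
    unfolding \<A>_def
  proof (intro CollectI conjI exI[of _ "X \<inter> ball a d"])
    show "compact (X \<inter> cball a d)" using compact_space by (simp add: compact_Int_closed)
    show "X \<inter> ball a d \<noteq> {}" using that(1,2) by force
  qed (use that in \<open>auto simp: openin_open_Int\<close>)
  have shrink: "\<exists>d>0. X \<inter> cball a d \<subseteq> W" if W: "openin (top_of_set X) W" "a \<in> W" for a W
  proof -
    obtain d where d: "d > 0" "\<And>z. z \<in> X \<Longrightarrow> dist z a < d \<Longrightarrow> z \<in> W"
      using W unfolding openin_euclidean_subtopology_iff by blast
    then have "X \<inter> cball a (d/2) \<subseteq> W" by (force simp: dist_commute)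
    then show ?thesis using d(1) by (intro exI[of _ "d/2"]) simp
  qed
  show False
  proof (rule equicontinuous_point_not_away[where \<A> = \<A> and x = x and \<eta> = \<eta>])
    show "pairwise_FIP_star_equicontinuous_point G X \<phi> x"
      using eq xyX unfolding pairwise_FIP_star_equicontinuous_def by blast
    show "\<exists>A0\<in>\<A>. A0 \<subseteq> U" if U: "openin (top_of_set X) U" "x \<in> U" for U
    proof -
      have "openin (top_of_set X) (U \<inter> ball x \<eta>)" using U(1) by (simp add: openin_Int_open)
      moreover have "x \<in> U \<inter> ball x \<eta>" using U(2) \<eta> by simp
      ultimately obtain d where "d > 0" "X \<inter> cball x d \<subseteq> U \<inter> ball x \<eta>" using shrink by blast
      then show ?thesis using ballA[OF xyX(1), of d] by blast
    qed
    show "\<exists>A'\<in>\<A>. A' \<subseteq> A \<and> (\<exists>p. p \<in> {1..k} \<rightarrow> carrier G \<and> (\<forall>g\<in>FP G k p. \<forall>a\<in>A'. 2 * \<eta> \<le> dist (\<phi> g a) x))"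
      if A\<A>: "A \<in> \<A>" for A k
    proof -
      obtain V where A: "A \<subseteq> X \<inter> ball x \<eta>" and V: "openin (top_of_set X) V" "V \<noteq> {}" "V \<subseteq> A"
        using A\<A> unfolding \<A>_def by blast
      \<comment> \<open>The point \<open>x\<close> need not lie in \<open>A\<close>. Carried along
        by \<open>t\<close>, the cube at \<open>x'\<close> starts at \<open>a\<close> in
        \<open>V\<close>, and by commutativity its products move \<open>a\<close> near
        \<open>t y\<close>.\<close>
      obtain t where t: "t \<in> carrier G" "\<phi> t x \<in> V" using dense_orbit[OF xyX(1) V(1,2)] by blast
      obtain d1 where d1: "d1 > 0" "\<forall>z\<in>X. dist x z < d1 \<longrightarrow> \<phi> t z \<in> V"
        using act_into_open[of "{t}" x V] t xyX V(1) by auto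
      obtain d2 where d2: "d2 > 0" "\<forall>z\<in>X. \<forall>z'\<in>X. dist z z' < d2 \<longrightarrow> dist (\<phi> t z) (\<phi> t z') < \<eta>"
        using act_uniform[of "{t}" \<eta>] t(1) \<eta> by auto
      obtain x' p where x': "x' \<in> X" "p \<in> {1..Suc k} \<rightarrow> carrier G" "dist x x' < min d1 d2"
        "\<And>g. g \<in> FP G (Suc k) p \<Longrightarrow> dist y (\<phi> g x') < min d1 d2"
        using RP_cube[OF RP[of k], of "min d1 d2"] d1(1) d2(1) by auto
      define a where "a = \<phi> t x'"
      have p: "p \<in> {1..k} \<rightarrow> carrier G" using x'(2) by auto
      have aV: "a \<in> V" using d1(2) x'(1,3) by (simp add: a_def)
      then have aX: "a \<in> X" "dist x a < \<eta>" using A V(3) by auto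
      have tx: "dist x (\<phi> t x) < \<eta>" using t(2) A V(3) by auto
      \<comment> \<open>Staying away from \<open>x\<close> is made an open condition, so that it
        extends from \<open>a\<close> to a neighborhood, the next member of
        \<open>\<A>\<close>.\<close>
      define W where "W = X \<inter> - cball x (2 * \<eta>)"
      have W: "openin (top_of_set X) W" unfolding W_def by (intro openin_open_Int) (simp add: open_Compl)
      have "\<phi> g a \<in> W" if g: "g \<in> FP G k p" for g
      proof -
        have gc: "g \<in> carrier G" using g FP_closed[OF p] by blast
        have "dist y (\<phi> g x') < d2" using x'(4)[of g] g FP_mono[of k "Suc k" p] by auto
        then have "dist (\<phi> t y) (\<phi> t (\<phi> g x')) < \<eta>" using d2(2) xyX(2) gc x'(1) by simp
        moreover have "\<phi> t (\<phi> g x') = \<phi> g a" using act_commute[OF gc t(1) x'(1)] by (simp add: a_def)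
        ultimately have "dist (\<phi> t y) (\<phi> g a) < \<eta>" by simp
        then have "2 * \<eta> < dist x (\<phi> g a)"
          using e(2)[OF t(1)] tx dist_triangle[of "\<phi> t x" "\<phi> t y" x] dist_triangle[of x "\<phi> t y" "\<phi> g a"]
          by (simp add: \<eta>_def dist_commute)
        then show ?thesis using gc aX(1) by (simp add: W_def)
      qed
      then obtain d3 where d3: "d3 > 0" "\<forall>z\<in>X. dist a z < d3 \<longrightarrow> (\<forall>g\<in>FP G k p. \<phi> g z \<in> W)"
        using act_into_open[OF finite_FP FP_closed[OF p] aX(1) W] by blast
      obtain d4 where d4: "d4 > 0" "X \<inter> cball a d4 \<subseteq> V" using shrink[OF V(1) aV] by blast
      define A' where "A' = X \<inter> cball a (min (d3/2) d4)"
      have sub: "A' \<subseteq> V" using d4(2) by (auto simp: A'_def)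
      have "A' \<in> \<A>"
        unfolding A'_def using d3(1) d4(1) aX(1) sub V(3) A by (intro ballA) (auto simp: A'_def)
      moreover have "2 * \<eta> \<le> dist (\<phi> g b) x" if "g \<in> FP G k p" "b \<in> A'" for g b
      proof -
        have "\<phi> g b \<in> W" using d3 that by (auto simp: A'_def)
        then show ?thesis by (simp add: W_def dist_commute)
      qed
      ultimately show ?thesis using sub V(3) p by blast
    qed
  qed (use xyX \<eta> in \<open>auto simp: \<A>_def\<close>)
qed

lemma (in abelian_minimal_system) equicontinuous_imp_order_infinity:
  assumes eq: "pairwise_FIP_star_equicontinuous G X \<phi>"
  shows "system_of_order_infinity G X \<phi>"
proof -
  interpret distal_system G X \<phi>
    by unfold_locales (rule equicontinuous_imp_distal[OF eq])
  have "(x, y) \<in> RP_infinity G X \<phi> \<longleftrightarrow> (x, y) \<in> Id_on X" for x y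
  proof
    assume xy: "(x, y) \<in> RP_infinity G X \<phi>"
    then have "x \<in> X" by (auto simp: RP_infinity_def RP_def)
    then show "(x, y) \<in> Id_on X" using equicontinuous_imp_RP_infinity_trivial[OF eq xy] by blast
  next
    assume "(x, y) \<in> Id_on X"
    then show "(x, y) \<in> RP_infinity G X \<phi>" using RP_diagonal by (auto simp: RP_infinity_def)
  qed
  then show ?thesis
    unfolding system_of_order_infinity_def by auto
qed

theorem theorem1p2:
  fixes G :: "('g, 'm) monoid_scheme"
    and X :: "'a::metric_space set"
    and \<phi> :: "'g \<Rightarrow> 'a \<Rightarrow> 'a"
  assumes "comm_group G"
    and "minimal_system G X \<phi>"
  shows "system_of_order_infinity G X \<phi> \<longleftrightarrow> pairwise_FIP_star_equicontinuous G X \<phi>"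
proof -
  interpret abelian_minimal_system G X \<phi>
    using assms by (simp add: abelian_minimal_system_def)
  show ?thesis
    using order_infinity_imp_equicontinuous equicontinuous_imp_order_infinity by blast
qed

end
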